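(* Let $X$ be a set, $K:X\times X\to\mathbb{C}$ a positive definite kernel with reproducing kernel Hilbert space $\mathscr{H}(K)$, $\mathscr{B}$ a sigma-algebra of subsets of $X$, and $\mu$ a positive sigma-finite measure on $(X,\mathscr{B})$. Assume that the operator $T$ given by $$\mathscr{H}(K)\ni f\xrightarrow{\;T\;}(f(x))_{x\in X}\in L^2(\mu)$$ is densely defined and closable. Fix $\beta>0$ and $\psi\in L^2(\mu)$, and set $$Q_{\psi,\beta}(f)=\|\psi-Tf\|_{L^2(\mu)}^2+\beta\|f\|_{\mathscr{H}(K)}^2,$$ defined for $f\in\mathscr{H}(K)$, or in the dense subspace $dom(T)$. Let $T^*:L^2(\mu)\to\mathscr{H}(K)$ be the corresponding adjoint operator. Then the optimization problem $$\inf_{f\in\mathscr{H}(K)}Q_{\psi,\beta}(f)$$ has a unique solution $F$ in $\mathscr{H}(K)$, and it is $$F=(\beta I+T^*T)^{-1}T^*\psi.$$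
   Context: Inner products are linear in the second variable. A function $K:X\times X\to\mathbb{C}$ is positive definite if for every finite subset $\{x_i\}_{i=1}^N\subset X$ the matrix $(K(x_i,x_j))$ is positive semidefinite. Its reproducing kernel Hilbert space $\mathscr{H}(K)$ is the Hilbert space of functions on $X$ such that $K(\cdot,x)\in\mathscr{H}(K)$ and $f(x)=\langle K(\cdot,x),f\rangle_{\mathscr{H}(K)}$ for all $x\in X$ and $f\in\mathscr{H}(K)$. The operator $T$ sends $f$ to the function $x\mapsto f(x)$ viewed as an element of $L^2(\mu)$; $dom(T)$ denotes its dense domain in $\mathscr{H}(K)$, and $I$ is the identity operator. The adjoint $T^*$ is given by $$\langle f,T^*\psi\rangle_{\mathscr{H}(K)}=\langle Tf,\psi\rangle_{L^2(\mu)}=\int_X\overline{f(s)}\,\psi(s)\,d\mu(s).$$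
   Formalization: T is replaced by its closure in Q and in T*T (a minimiser need not lie in dom(T) otherwise), with Q infinite off the domain; for ψ outside dom(T* ), where T*ψ is undefined, F is the value at ψ of the closure of (βI+T*T)^{-1}T*. *)

theory Defs
  imports "HOL-Analysis.Analysis"
begin

text \<open>
  Spaces of complex-valued functions with pointwise linear structure, given by a carrier
  \<open>vecs\<close> and an inner product \<open>cip\<close> that is linear in the second variable.
  The same format serves for reproducing kernel Hilbert spaces and for
  \<open>L\<^sup>2(\<mu>)\<close>; elements of the latter are given by representatives, so its
  \<open>cip\<close> is definite only up to equality almost everywhere.
\<close>

record 'a fun_space =
  vecs :: "('a \<Rightarrow> complex) set"
  cip :: "('a \<Rightarrow> complex) \<Rightarrow> ('a \<Rightarrow> complex) \<Rightarrow> complex"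

definition vnorm :: "'a fun_space \<Rightarrow> ('a \<Rightarrow> complex) \<Rightarrow> real" where
  "vnorm V f = sqrt (Re (cip V f f))"

definition conv_to :: "'a fun_space \<Rightarrow> (nat \<Rightarrow> 'a \<Rightarrow> complex) \<Rightarrow> ('a \<Rightarrow> complex) \<Rightarrow> bool" where
  "conv_to V u f \<longleftrightarrow> (\<lambda>n. vnorm V (\<lambda>x. u n x - f x)) \<longlonglongrightarrow> 0"

definition cauchy_in :: "'a fun_space \<Rightarrow> (nat \<Rightarrow> 'a \<Rightarrow> complex) \<Rightarrow> bool" where
  "cauchy_in V u \<longleftrightarrow>
     (\<forall>e>0. \<exists>N. \<forall>m\<ge>N. \<forall>n\<ge>N. vnorm V (\<lambda>x. u m x - u n x) < e)"

definition lin_subspace :: "('a \<Rightarrow> complex) set \<Rightarrow> bool" where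
  "lin_subspace D \<longleftrightarrow>
     (\<lambda>_. 0) \<in> D \<and>
     (\<forall>f\<in>D. \<forall>g\<in>D. (\<lambda>x. f x + g x) \<in> D) \<and>
     (\<forall>c. \<forall>f\<in>D. (\<lambda>x. c * f x) \<in> D)"

definition dense_in :: "'a fun_space \<Rightarrow> ('a \<Rightarrow> complex) set \<Rightarrow> bool" where
  "dense_in V D \<longleftrightarrow> D \<subseteq> vecs V \<and> (\<forall>f\<in>vecs V. \<forall>e>0. \<exists>g\<in>D. vnorm V (\<lambda>x. f x - g x) < e)"

locale hilbert_fun_space =
  fixes H :: "'a fun_space"
  assumes subspace: "lin_subspace (vecs H)"
    and cip_cnj: "f \<in> vecs H \<Longrightarrow> g \<in> vecs H \<Longrightarrow> cip H g f = cnj (cip H f g)"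
    and cip_add: "f \<in> vecs H \<Longrightarrow> g \<in> vecs H \<Longrightarrow> h \<in> vecs H \<Longrightarrow>
      cip H f (\<lambda>x. g x + h x) = cip H f g + cip H f h"
    and cip_scale: "f \<in> vecs H \<Longrightarrow> g \<in> vecs H \<Longrightarrow> cip H f (\<lambda>x. c * g x) = c * cip H f g"
    and cip_nonneg: "f \<in> vecs H \<Longrightarrow> 0 \<le> Re (cip H f f)"
    and cip_definite: "f \<in> vecs H \<Longrightarrow> cip H f f = 0 \<Longrightarrow> f = (\<lambda>_. 0)"
    and complete: "(\<And>n. u n \<in> vecs H) \<Longrightarrow> cauchy_in H u \<Longrightarrow> \<exists>f\<in>vecs H. conv_to H u f"

definition pos_def_kernel :: "'a set \<Rightarrow> ('a \<Rightarrow> 'a \<Rightarrow> complex) \<Rightarrow> bool" where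
  "pos_def_kernel X K \<longleftrightarrow>
     (\<forall>A c. finite A \<longrightarrow> A \<subseteq> X \<longrightarrow>
        (\<Sum>x\<in>A. \<Sum>y\<in>A. cnj (c x) * K x y * c y) \<in> \<real>\<^sub>\<ge>\<^sub>0)"

text \<open>Functions on \<open>X\<close> are represented by functions that vanish outside \<open>X\<close>.\<close>

definition kernel_section :: "'a set \<Rightarrow> ('a \<Rightarrow> 'a \<Rightarrow> complex) \<Rightarrow> 'a \<Rightarrow> 'a \<Rightarrow> complex" where
  "kernel_section X K x = (\<lambda>y. if y \<in> X then K y x else 0)"

locale rkhs = hilbert_fun_space H
  for X :: "'a set" and K :: "'a \<Rightarrow> 'a \<Rightarrow> complex" and H :: "'a fun_space" +
  assumes vanish_outside: "f \<in> vecs H \<Longrightarrow> x \<notin> X \<Longrightarrow> f x = 0"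
    and section_mem: "x \<in> X \<Longrightarrow> kernel_section X K x \<in> vecs H"
    and reproducing: "x \<in> X \<Longrightarrow> f \<in> vecs H \<Longrightarrow> f x = cip H (kernel_section X K x) f"

definition L2 :: "'a measure \<Rightarrow> 'a fun_space" where
  "L2 M = \<lparr> vecs = {f. f \<in> borel_measurable M \<and> integrable M (\<lambda>x. (cmod (f x))\<^sup>2)},
            cip = (\<lambda>f g. LINT x|M. cnj (f x) * g x) \<rparr>"

text \<open>
  An unbounded operator is given by its graph; the domain is \<open>Domain\<close>. Because
  elements of \<open>L\<^sup>2(\<mu>)\<close> are representatives, graphs of operators into that space
  contain every representative of each value.
\<close>

type_synonym 'a linop = "(('a \<Rightarrow> complex) \<times> ('a \<Rightarrow> complex)) set"

definition op_closure :: "'a fun_space \<Rightarrow> 'a fun_space \<Rightarrow> 'a linop \<Rightarrow> 'a linop" where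
  "op_closure U V T = {(f, h). f \<in> vecs U \<and> h \<in> vecs V \<and>
     (\<exists>u v. (\<forall>n. (u n, v n) \<in> T) \<and> conv_to U u f \<and> conv_to V v h)}"

definition closable :: "'a fun_space \<Rightarrow> 'a fun_space \<Rightarrow> 'a linop \<Rightarrow> bool" where
  "closable U V T \<longleftrightarrow> (\<forall>h. ((\<lambda>_. 0), h) \<in> op_closure U V T \<longrightarrow> vnorm V h = 0)"

definition adjoint_op :: "'a fun_space \<Rightarrow> 'a fun_space \<Rightarrow> 'a linop \<Rightarrow> 'a linop" where
  "adjoint_op U V T = {(\<psi>, g). \<psi> \<in> vecs V \<and> g \<in> vecs U \<and>
     (\<forall>(f, h)\<in>T. cip U f g = cip V h \<psi>)}"

text \<open>The operator \<open>\<beta> I + S\<close>, with the domain of \<open>S\<close>.\<close>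

definition shift_op :: "real \<Rightarrow> 'a linop \<Rightarrow> 'a linop" where
  "shift_op \<beta> S = {(f, (\<lambda>x. complex_of_real \<beta> * f x + g x)) | f g. (f, g) \<in> S}"

text \<open>
  The operator sending \<open>f \<in> D\<close> to itself, viewed as an element of \<open>L\<^sup>2(\<mu>)\<close>;
  \<open>eval_max_dom\<close> is the largest domain on which this makes sense.
\<close>

definition eval_op :: "'a measure \<Rightarrow> ('a \<Rightarrow> complex) set \<Rightarrow> 'a linop" where
  "eval_op M D = {(f, h). f \<in> D \<and> h \<in> vecs (L2 M) \<and> (AE x in M. h x = f x)}"

definition eval_max_dom :: "'a measure \<Rightarrow> 'a fun_space \<Rightarrow> ('a \<Rightarrow> complex) set" where
  "eval_max_dom M H = {f \<in> vecs H. \<exists>h\<in>vecs (L2 M). AE x in M. h x = f x}"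

text \<open>
  The functional \<open>Q\<close>, with value \<open>\<infinity>\<close> off the domain of \<open>T\<close>.
  For single-valued \<open>T\<close> the choice only selects a representative of
  \<open>T f\<close>, on which the norm does not depend.
\<close>

definition tikhonov ::
  "'a fun_space \<Rightarrow> 'a fun_space \<Rightarrow> real \<Rightarrow> ('a \<Rightarrow> complex) \<Rightarrow> 'a linop \<Rightarrow> ('a \<Rightarrow> complex) \<Rightarrow> ereal"
where
  "tikhonov U V \<beta> \<psi> T f =
     (if f \<in> Domain T
      then ereal ((vnorm V (\<lambda>x. \<psi> x - (SOME h. (f, h) \<in> T) x))\<^sup>2 + \<beta> * (vnorm U f)\<^sup>2)
      else \<infinity>)"

text \<open>
  The operator \<open>(\<beta> I + S\<^sup>* S)\<^sup>-\<^sup>1 S\<^sup>*\<close> on the domain of \<open>S\<^sup>*\<close>.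
  When \<open>S\<close> is unbounded this domain is only dense, and the value of the expression at
  an arbitrary \<open>\<psi>\<close> is that of the closure of \<open>solution_op\<close>.
  Relational composition \<open>O\<close> applies its left argument first.
\<close>

definition normal_op :: "'a fun_space \<Rightarrow> 'a fun_space \<Rightarrow> real \<Rightarrow> 'a linop \<Rightarrow> 'a linop" where
  "normal_op U V \<beta> S = shift_op \<beta> (S O adjoint_op U V S)"

definition solution_op :: "'a fun_space \<Rightarrow> 'a fun_space \<Rightarrow> real \<Rightarrow> 'a linop \<Rightarrow> 'a linop" where
  "solution_op U V \<beta> S = adjoint_op U V S O (normal_op U V \<beta> S)\<inverse>"

end

theory Submission imports Defs begin

text \<open>
  Everything follows from the Hilbert projection theorem in the direct sum of
  \<open>H\<close>, weighted by \<open>\<beta>\<close>, and \<open>L\<^sup>2(\<mu>)\<close>. Projecting \<open>(g / \<beta>, 0)\<close> onto the graph of the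
  closure \<open>S\<close> of \<open>T\<close> solves \<open>(\<beta> I + S\<^sup>* S) f = g\<close>. Projecting \<open>(0, \<psi>)\<close> yields
  \<open>(F, S F)\<close> with \<open>S\<^sup>* (\<psi> - S F) = \<beta> F\<close>, and Pythagoras shows that \<open>F\<close> is the unique
  minimiser. The map \<open>\<psi> \<mapsto> F\<close> is bounded and extends \<open>(\<beta> I + S\<^sup>* S)\<^sup>-\<^sup>1 S\<^sup>*\<close>, whose domain is dense
  because \<open>S\<close> is closable.
\<close>

text \<open>Elements of L2 are representatives, so its inner product is only semidefinite, and
  limits and projections there are determined up to null functions. The Hilbert space arguments are
  therefore carried out for seminorms. Equality of functions is concluded only in \<open>H\<close>,
  where definiteness makes the minimiser unique as a function. The weight \<beta> makes the squared
  distance from (0, \<psi>) to a graph point (f, h) equal to \<parallel>\<psi> - h\<parallel>^2 +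
  \<beta> \<parallel>f\<parallel>^2, which is the functional itself. The infimum may fail to be
  attained on the domain of \<open>T\<close>, which is why the closure enters. Its elements are
  limits of sequences in the graph of \<open>T\<close>, so the projection theorem is stated for
  arbitrary subspaces and returns an approximating sequence along with the projection.\<close>

lemma lin_subspace_add: "lin_subspace D \<Longrightarrow> f \<in> D \<Longrightarrow> g \<in> D \<Longrightarrow> (\<lambda>x. f x + g x) \<in> D"
  and lin_subspace_scale: "lin_subspace D \<Longrightarrow> f \<in> D \<Longrightarrow> (\<lambda>x. c * f x) \<in> D"
  and lin_subspace_zero: "lin_subspace D \<Longrightarrow> (\<lambda>_. 0) \<in> D"
  by (simp_all add: lin_subspace_def)

lemma lin_subspace_diff:
  assumes "lin_subspace D" "f \<in> D" "g \<in> D"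
  shows "(\<lambda>x. f x - g x) \<in> D"
  using lin_subspace_add[OF assms(1,2) lin_subspace_scale[OF assms(1,3), of "-1"]] by simp

section \<open>Semi-inner product spaces of functions\<close>

locale semi_inner_space =
  fixes V :: "'a fun_space"
  assumes subsp: "lin_subspace (vecs V)"
    and cnj_cip: "f \<in> vecs V \<Longrightarrow> g \<in> vecs V \<Longrightarrow> cip V g f = cnj (cip V f g)"
    and cip_add_right: "f \<in> vecs V \<Longrightarrow> g \<in> vecs V \<Longrightarrow> h \<in> vecs V \<Longrightarrow>
      cip V f (\<lambda>x. g x + h x) = cip V f g + cip V f h"
    and cip_scale_right: "f \<in> vecs V \<Longrightarrow> g \<in> vecs V \<Longrightarrow> cip V f (\<lambda>x. c * g x) = c * cip V f g"
    and Re_cip_nonneg: "f \<in> vecs V \<Longrightarrow> 0 \<le> Re (cip V f f)"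
begin

lemmas add_mem [simp] = lin_subspace_add[OF subsp]
  and scale_mem [simp] = lin_subspace_scale[OF subsp]
  and zero_mem [simp] = lin_subspace_zero[OF subsp]
  and diff_mem [simp] = lin_subspace_diff[OF subsp]

lemma cip_diff_right:
  assumes "f \<in> vecs V" "g \<in> vecs V" "h \<in> vecs V"
  shows "cip V f (\<lambda>x. g x - h x) = cip V f g - cip V f h"
  using cip_add_right[OF assms(1,2) scale_mem[OF assms(3), of "-1"]]
    cip_scale_right[OF assms(1,3), of "-1"] by simp

lemma cip_add_left:
  assumes "f \<in> vecs V" "g \<in> vecs V" "h \<in> vecs V"
  shows "cip V (\<lambda>x. f x + g x) h = cip V f h + cip V g h"
  using assms cnj_cip[of h "\<lambda>x. f x + g x"] cnj_cip[of h f] cnj_cip[of h g]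
  by (simp add: cip_add_right)

lemma cip_diff_left:
  assumes "f \<in> vecs V" "g \<in> vecs V" "h \<in> vecs V"
  shows "cip V (\<lambda>x. f x - g x) h = cip V f h - cip V g h"
  using assms cnj_cip[of h "\<lambda>x. f x - g x"] cnj_cip[of h f] cnj_cip[of h g]
  by (simp add: cip_diff_right)

lemma cip_scale_left:
  assumes "f \<in> vecs V" "h \<in> vecs V"
  shows "cip V (\<lambda>x. c * f x) h = cnj c * cip V f h"
  using assms cnj_cip[of h "\<lambda>x. c * f x"] cnj_cip[of h f]
  by (simp add: cip_scale_right)

lemma cip_zero_right [simp]: "f \<in> vecs V \<Longrightarrow> cip V f (\<lambda>_. 0) = 0"
  using cip_scale_right[of f "\<lambda>_. 0" 0] by simp

lemma cip_zero_left [simp]: "f \<in> vecs V \<Longrightarrow> cip V (\<lambda>_. 0) f = 0"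
  using cnj_cip[of f "\<lambda>_. 0"] by simp

lemma vnorm_nonneg [simp]: "f \<in> vecs V \<Longrightarrow> 0 \<le> vnorm V f"
  by (simp add: vnorm_def Re_cip_nonneg)

lemma vnorm_power2: "f \<in> vecs V \<Longrightarrow> (vnorm V f)\<^sup>2 = Re (cip V f f)"
  by (simp add: vnorm_def Re_cip_nonneg)

lemma cip_self: "f \<in> vecs V \<Longrightarrow> cip V f f = complex_of_real ((vnorm V f)\<^sup>2)"
  using cnj_cip[of f f] by (simp add: vnorm_power2 complex_eq_iff)

lemma Re_cip_commute: "f \<in> vecs V \<Longrightarrow> g \<in> vecs V \<Longrightarrow> Re (cip V f g) = Re (cip V g f)"
  using cnj_cip[of f g] by simp

lemma vnorm_zero [simp]: "vnorm V (\<lambda>_. 0) = 0"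
  by (simp add: vnorm_def)

lemma vnorm_scale:
  assumes "f \<in> vecs V"
  shows "vnorm V (\<lambda>x. c * f x) = cmod c * vnorm V f"
proof (rule power2_eq_imp_eq)
  have "cip V (\<lambda>x. c * f x) (\<lambda>x. c * f x) = (c * cnj c) * cip V f f"
    using assms by (simp add: cip_scale_left cip_scale_right)
  also have "c * cnj c = complex_of_real ((cmod c)\<^sup>2)"
    by (rule complex_norm_square[symmetric])
  finally show "(vnorm V (\<lambda>x. c * f x))\<^sup>2 = (cmod c * vnorm V f)\<^sup>2"
    using assms by (simp add: vnorm_power2 power_mult_distrib)
qed (use assms in auto)

lemma vnorm_diff_power2:
  assumes "f \<in> vecs V" "g \<in> vecs V"
  shows "(vnorm V (\<lambda>x. f x - g x))\<^sup>2 = (vnorm V f)\<^sup>2 - 2 * Re (cip V f g) + (vnorm V g)\<^sup>2"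
  using assms Re_cip_commute[of f g]
  by (simp add: vnorm_power2 cip_diff_left cip_diff_right)

lemma vnorm_add_power2:
  assumes "f \<in> vecs V" "g \<in> vecs V"
  shows "(vnorm V (\<lambda>x. f x + g x))\<^sup>2 = (vnorm V f)\<^sup>2 + 2 * Re (cip V f g) + (vnorm V g)\<^sup>2"
  using assms Re_cip_commute[of f g]
  by (simp add: vnorm_power2 cip_add_left cip_add_right)

lemma parallelogram:
  assumes "f \<in> vecs V" "g \<in> vecs V"
  shows "(vnorm V (\<lambda>x. f x - g x))\<^sup>2 + (vnorm V (\<lambda>x. f x + g x))\<^sup>2
    = 2 * (vnorm V f)\<^sup>2 + 2 * (vnorm V g)\<^sup>2"
  by (simp add: assms vnorm_add_power2 vnorm_diff_power2)

lemma vnorm_minus_commute: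
  assumes "f \<in> vecs V" "g \<in> vecs V"
  shows "vnorm V (\<lambda>x. f x - g x) = vnorm V (\<lambda>x. g x - f x)"
  using vnorm_scale[OF diff_mem[OF assms], of "-1"] by simp

lemma orthogonal_if_minimal:
  assumes f: "f \<in> vecs V" and g: "g \<in> vecs V"
    and min: "\<And>c. (vnorm V f)\<^sup>2 \<le> (vnorm V (\<lambda>x. f x - c * g x))\<^sup>2"
  shows "cip V g f = 0"
proof -
  define a where "a = cip V g f"
  define N where "N = (vnorm V g)\<^sup>2"
  \<comment> \<open>The best multiple of \<open>g\<close> to subtract would be \<open>a / N\<close>.
    Replacing \<open>N\<close> by \<open>1 + N\<close> keeps the denominator positive when
    \<open>g\<close> is a null vector and still gives \<open>t * N \<le> 1\<close>.\<close>
  define t where "t = 1 / (1 + N)"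
  have N: "0 \<le> N" by (simp add: N_def)
  have t: "0 < t" "t * N \<le> 1" using N by (simp_all add: t_def)
  have "cip V f g = cnj a" using f g by (simp add: a_def cnj_cip[of g f])
  then have "Re (cip V f (\<lambda>x. (of_real t * a) * g x)) = t * (cmod a)\<^sup>2"
    using f g by (simp add: cip_scale_right mult.assoc complex_norm_square[symmetric] del: of_real_power)
  moreover have "(vnorm V (\<lambda>x. (of_real t * a) * g x))\<^sup>2 = t\<^sup>2 * (cmod a)\<^sup>2 * N"
    using g t by (simp only: vnorm_scale) (simp add: norm_mult power_mult_distrib N_def)
  ultimately have "2 * (t * (cmod a)\<^sup>2) \<le> t\<^sup>2 * (cmod a)\<^sup>2 * N"
    using min[of "of_real t * a"] f g by (simp add: vnorm_diff_power2 mult.assoc)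
  also have "\<dots> = (t * N) * (t * (cmod a)\<^sup>2)"
    by (simp add: power2_eq_square)
  also have "\<dots> \<le> 1 * (t * (cmod a)\<^sup>2)"
    by (rule mult_right_mono) (use t in auto)
  finally have "t * (cmod a)\<^sup>2 \<le> 0" by simp
  with t have "(cmod a)\<^sup>2 \<le> 0" by (simp add: mult_le_0_iff)
  then show ?thesis by (simp add: a_def)
qed

text \<open>Expand \<parallel>g - t a f\<parallel>^2 \<ge> 0 for real t. If \<parallel>f\<parallel>
  > 0, take t = 1 / \<parallel>f\<parallel>^2. A null \<open>f\<close> need not be the zero
  function, but then the inequality has no quadratic term and, as t is arbitrary, forces a =
  0.\<close>

lemma Cauchy_Schwarz:
  assumes f: "f \<in> vecs V" and g: "g \<in> vecs V"
  shows "cmod (cip V f g) \<le> vnorm V f * vnorm V g"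
proof -
  define a where "a = cip V f g"
  define N where "N = (vnorm V f)\<^sup>2"
  have exp: "(vnorm V (\<lambda>x. g x - c * f x))\<^sup>2 = (vnorm V g)\<^sup>2 - 2 * Re (c * cnj a) + (cmod c)\<^sup>2 * N" for c
    using f g by (simp add: vnorm_diff_power2 cip_scale_right vnorm_scale power_mult_distrib a_def N_def
        cnj_cip[of f g])
  have key: "2 * t * (cmod a)\<^sup>2 \<le> (vnorm V g)\<^sup>2 + t\<^sup>2 * (cmod a)\<^sup>2 * N" for t
  proof -
    have "Re (of_real t * a * cnj a) = t * (cmod a)\<^sup>2"
      by (simp add: mult.assoc complex_norm_square[symmetric] del: of_real_power)
    moreover have "(cmod (of_real t * a))\<^sup>2 = t\<^sup>2 * (cmod a)\<^sup>2"
      by (simp add: norm_mult power_mult_distrib)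
    moreover have "0 \<le> (vnorm V (\<lambda>x. g x - (of_real t * a) * f x))\<^sup>2" by simp
    ultimately show ?thesis unfolding exp by simp
  qed
  have "(cmod a)\<^sup>2 \<le> N * (vnorm V g)\<^sup>2"
  proof (cases "N = 0")
    case True
    have "(cmod a)\<^sup>2 = 0"
    proof (rule ccontr)
      assume "(cmod a)\<^sup>2 \<noteq> 0"
      \<comment> \<open>This t makes the left side of \<open>key\<close> equal to
        \<parallel>g\<parallel>^2 + 1, while its right side is \<parallel>g\<parallel>^2.\<close>
      then show False
        using key[of "((vnorm V g)\<^sup>2 + 1) / (2 * (cmod a)\<^sup>2)"] True by (simp add: field_simps)
    qed
    with True show ?thesis by simp
  next
    case False
    then have "N > 0" by (simp add: N_def)
    with key[of "1 / N"] show ?thesis by (simp add: field_simps power2_eq_square)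
  qed
  then have "(cmod a)\<^sup>2 \<le> (vnorm V f * vnorm V g)\<^sup>2"
    by (simp add: N_def power_mult_distrib)
  then show ?thesis unfolding a_def by (rule power2_le_imp_le) (use f g in auto)
qed

lemma vnorm_add_le:
  assumes "f \<in> vecs V" "g \<in> vecs V"
  shows "vnorm V (\<lambda>x. f x + g x) \<le> vnorm V f + vnorm V g"
proof (rule power2_le_imp_le)
  show "(vnorm V (\<lambda>x. f x + g x))\<^sup>2 \<le> (vnorm V f + vnorm V g)\<^sup>2"
    using Cauchy_Schwarz[OF assms] complex_Re_le_cmod[of "cip V f g"]
    by (simp add: vnorm_add_power2 assms power2_sum)
qed (use assms in auto)

lemma vnorm_triangle:
  assumes "f \<in> vecs V" "g \<in> vecs V" "h \<in> vecs V"
  shows "vnorm V (\<lambda>x. f x - h x) \<le> vnorm V (\<lambda>x. f x - g x) + vnorm V (\<lambda>x. g x - h x)"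
  using vnorm_add_le[of "\<lambda>x. f x - g x" "\<lambda>x. g x - h x"] assms by simp

lemma vnorm_diff_le:
  assumes "f \<in> vecs V" "g \<in> vecs V"
  shows "\<bar>vnorm V f - vnorm V g\<bar> \<le> vnorm V (\<lambda>x. f x - g x)"
  using vnorm_triangle[of f g "\<lambda>_. 0"] vnorm_triangle[of g f "\<lambda>_. 0"]
    vnorm_minus_commute[OF assms] assms by auto

section \<open>Convergence in the seminorm and continuity of norm and inner product\<close>

lemma conv_to_const: "f \<in> vecs V \<Longrightarrow> conv_to V (\<lambda>_. f) f"
  by (simp add: conv_to_def)

lemma conv_to_diff:
  assumes "\<And>n. u n \<in> vecs V" "\<And>n. v n \<in> vecs V" "f \<in> vecs V" "g \<in> vecs V"
    and "conv_to V u f" "conv_to V v g"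
  shows "conv_to V (\<lambda>n x. u n x - v n x) (\<lambda>x. f x - g x)"
  unfolding conv_to_def
proof (rule tendsto_sandwich[OF _ _ tendsto_const])
  show "(\<lambda>n. vnorm V (\<lambda>x. u n x - f x) + vnorm V (\<lambda>x. g x - v n x)) \<longlonglongrightarrow> 0"
    using tendsto_add[OF assms(5,6)[unfolded conv_to_def]] assms(1-4)
    by (simp add: vnorm_minus_commute[of g])
  show "\<forall>\<^sub>F n in sequentially. vnorm V (\<lambda>x. u n x - v n x - (f x - g x))
      \<le> vnorm V (\<lambda>x. u n x - f x) + vnorm V (\<lambda>x. g x - v n x)"
  proof (rule always_eventually, rule allI)
    fix n
    have "(\<lambda>x. u n x - v n x - (f x - g x)) = (\<lambda>x. (u n x - f x) + (g x - v n x))" by auto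
    then show "vnorm V (\<lambda>x. u n x - v n x - (f x - g x))
      \<le> vnorm V (\<lambda>x. u n x - f x) + vnorm V (\<lambda>x. g x - v n x)"
      using vnorm_add_le[of "\<lambda>x. u n x - f x" "\<lambda>x. g x - v n x"] assms(1-4) by simp
  qed
qed (use assms in auto)

lemma conv_to_vnorm:
  assumes "\<And>n. u n \<in> vecs V" "f \<in> vecs V" "conv_to V u f"
  shows "(\<lambda>n. vnorm V (u n)) \<longlonglongrightarrow> vnorm V f"
proof -
  have "(\<lambda>n. vnorm V (u n) - vnorm V f) \<longlonglongrightarrow> 0"
    by (rule tendsto_0_le[OF assms(3)[unfolded conv_to_def], of _ 1])
      (use assms vnorm_diff_le in auto)
  then show ?thesis by (simp add: LIM_zero_iff)
qed

lemma conv_to_cip_left: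
  assumes "\<And>n. u n \<in> vecs V" "f \<in> vecs V" "g \<in> vecs V" "conv_to V u f"
  shows "(\<lambda>n. cip V (u n) g) \<longlonglongrightarrow> cip V f g"
proof -
  have "(\<lambda>n. cip V (u n) g - cip V f g) \<longlonglongrightarrow> 0"
  proof (rule tendsto_0_le[OF assms(4)[unfolded conv_to_def], of _ "vnorm V g"])
    show "\<forall>\<^sub>F n in sequentially. norm (cip V (u n) g - cip V f g)
        \<le> norm (vnorm V (\<lambda>x. u n x - f x)) * vnorm V g"
      using assms(1-3) Cauchy_Schwarz[of "\<lambda>x. u _ x - f x" g]
      by (auto simp: cip_diff_left[symmetric])
  qed
  then show ?thesis by (simp add: LIM_zero_iff)
qed

lemma conv_to_unique:
  assumes "\<And>n. u n \<in> vecs V" "f \<in> vecs V" "g \<in> vecs V" "conv_to V u f" "conv_to V u g"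
  shows "vnorm V (\<lambda>x. f x - g x) = 0"
proof -
  have "conv_to V (\<lambda>n x. u n x - u n x) (\<lambda>x. f x - g x)"
    using assms by (intro conv_to_diff)
  then have "(\<lambda>n. vnorm V (\<lambda>_. 0)) \<longlonglongrightarrow> vnorm V (\<lambda>x. f x - g x)"
    using assms by (intro conv_to_vnorm) auto
  then show ?thesis by (simp add: LIMSEQ_const_iff)
qed

end

section \<open>The projection theorem\<close>

locale semi_hilbert_space = semi_inner_space +
  assumes cauchy_imp_conv: "(\<And>n. u n \<in> vecs V) \<Longrightarrow> cauchy_in V u \<Longrightarrow> \<exists>f\<in>vecs V. conv_to V u f"
begin

text \<open>A minimising sequence is Cauchy by the parallelogram law, and its limit is the
  projection onto the closure of \<open>G\<close>. The sequence is part of the result because it is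
  what shows the limit to lie in that closure.\<close>

lemma ex_projection:
  assumes G: "lin_subspace G" "G \<subseteq> vecs V" and v: "v \<in> vecs V"
  obtains p u where "p \<in> vecs V" "\<And>n. u n \<in> G" "conv_to V u p"
    "\<And>g. g \<in> G \<Longrightarrow> cip V g (\<lambda>x. v x - p x) = 0"
proof -
  let ?q = "\<lambda>g. (vnorm V (\<lambda>x. v x - g x))\<^sup>2"
  define d where "d = (INF g\<in>G. ?q g)"
  have GV: "g \<in> vecs V" if "g \<in> G" for g using that G by auto
  have bdd: "bdd_below (?q ` G)" by (rule bdd_belowI2[of _ 0]) simp
  have ne: "G \<noteq> {}" using lin_subspace_zero[OF G(1)] by blast
  have d: "d \<le> ?q g" if "g \<in> G" for g
    unfolding d_def by (rule cINF_lower[OF bdd that])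
  have "\<exists>g\<in>G. ?q g < d + 1 / Suc n" for n
    using cINF_less_iff[OF ne bdd, of "d + 1 / Suc n"] by (simp add: d_def)
  then obtain u where uG: "\<And>n. u n \<in> G" and u: "\<And>n. ?q (u n) < d + 1 / Suc n"
    by metis
  have uV: "\<And>n. u n \<in> vecs V" using uG GV by blast
  \<comment> \<open>Parallelogram law for \<open>v - u m\<close> and \<open>v - u n\<close>: their
    sum is twice the difference of \<open>v\<close> and the midpoint, which lies in
    \<open>G\<close>, so its square is at least 4 d. The terms in d cancel.\<close>
  have par: "(vnorm V (\<lambda>x. u m x - u n x))\<^sup>2 \<le> 2 / Suc m + 2 / Suc n" for m n
  proof -
    let ?a = "\<lambda>x. v x - u m x" and ?b = "\<lambda>x. v x - u n x"
    let ?m = "\<lambda>x. (1/2) * (u m x + u n x)"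
    have mG: "?m \<in> G" by (intro lin_subspace_scale lin_subspace_add G uG)
    have 1: "(\<lambda>x. u m x - u n x) = (\<lambda>x. ?b x - ?a x)" by auto
    have "(\<lambda>x. ?b x + ?a x) = (\<lambda>x. 2 * (v x - ?m x))" by (auto simp: field_simps)
    then have 2: "(vnorm V (\<lambda>x. ?b x + ?a x))\<^sup>2 = 4 * ?q ?m"
      using v GV[OF mG] by (simp only: vnorm_scale diff_mem) (simp add: power_mult_distrib)
    have "(vnorm V (\<lambda>x. ?b x - ?a x))\<^sup>2 + (vnorm V (\<lambda>x. ?b x + ?a x))\<^sup>2 = 2 * ?q (u n) + 2 * ?q (u m)"
      by (intro parallelogram diff_mem v uV)
    then show ?thesis using d[OF mG] u[of m] u[of n] unfolding 1 2 by simp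
  qed
  have "cauchy_in V u"
    unfolding cauchy_in_def
  proof (intro allI impI)
    fix e :: real assume "e > 0"
    then obtain N where N: "inverse (real (Suc N)) < e\<^sup>2 / 4"
      using reals_Archimedean[of "e\<^sup>2 / 4"] by auto
    show "\<exists>N. \<forall>m\<ge>N. \<forall>n\<ge>N. vnorm V (\<lambda>x. u m x - u n x) < e"
    proof (intro exI allI impI)
      fix m n assume "N \<le> m" "N \<le> n"
      then have "2 / real (Suc m) \<le> 2 / Suc N" "2 / real (Suc n) \<le> 2 / Suc N"
        by (auto intro!: divide_left_mono)
      moreover have "2 / real (Suc N) < e\<^sup>2 / 2" using N by (simp add: field_simps)
      ultimately have "(vnorm V (\<lambda>x. u m x - u n x))\<^sup>2 < e\<^sup>2" using par[of m n] by linarith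
      then show "vnorm V (\<lambda>x. u m x - u n x) < e"
        using \<open>e > 0\<close> by (simp add: power2_less_imp_less)
    qed
  qed
  then obtain p where p: "p \<in> vecs V" "conv_to V u p" using cauchy_imp_conv uV by blast
  \<comment> \<open>The limit \<open>p\<close> may lie outside \<open>G\<close>, so
    \<open>p + c g\<close> is not a competitor for the infimum. It is reached through
    \<open>u n + c g\<close>, which is; c = 0 and g = 0 give the value at \<open>p\<close>.\<close>
  have lim: "(\<lambda>n. ?q (\<lambda>x. u n x + c * g x)) \<longlonglongrightarrow> (vnorm V (\<lambda>x. (v x - p x) - c * g x))\<^sup>2"
    if "g \<in> G" for g c
  proof -
    have g: "g \<in> vecs V" using that GV by blast
    let ?w = "\<lambda>x. v x - c * g x"
    have "(\<lambda>n. vnorm V (\<lambda>x. ?w x - u n x)) \<longlonglongrightarrow> vnorm V (\<lambda>x. ?w x - p x)"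
      using g v p uV by (intro conv_to_vnorm conv_to_diff conv_to_const) auto
    then have "(\<lambda>n. (vnorm V (\<lambda>x. ?w x - u n x))\<^sup>2) \<longlonglongrightarrow> (vnorm V (\<lambda>x. ?w x - p x))\<^sup>2"
      by (intro tendsto_intros)
    then show ?thesis by (simp add: algebra_simps)
  qed
  have "(\<lambda>n. ?q (u n)) \<longlonglongrightarrow> ?q p" using lim[OF lin_subspace_zero[OF G(1)], of 0] by simp
  moreover have "(\<lambda>n. d + 1 / real (Suc n)) \<longlonglongrightarrow> d + 0"
    by (intro tendsto_intros) (use LIMSEQ_Suc[OF lim_1_over_n] in simp)
  ultimately have pd: "?q p \<le> d"
    using u by (intro LIMSEQ_le[where X = "\<lambda>n. ?q (u n)"]) (auto intro: less_imp_le)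
  have "cip V g (\<lambda>x. v x - p x) = 0" if g: "g \<in> G" for g
  proof (rule orthogonal_if_minimal)
    show "?q p \<le> (vnorm V (\<lambda>x. (v x - p x) - c * g x))\<^sup>2" for c
    proof -
      have "d \<le> ?q (\<lambda>x. u n x + c * g x)" for n
        by (intro d lin_subspace_add lin_subspace_scale G uG g)
      then have "d \<le> (vnorm V (\<lambda>x. (v x - p x) - c * g x))\<^sup>2"
        by (intro LIMSEQ_le_const[OF lim[OF g]]) auto
      with pd show ?thesis by linarith
    qed
  qed (use v p GV g in auto)
  with p uG show ?thesis by (rule_tac that) auto
qed

end

lemma hilbert_imp_semi_hilbert: "hilbert_fun_space H \<Longrightarrow> semi_hilbert_space H"
  unfolding hilbert_fun_space_def semi_hilbert_space_def semi_inner_space_def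
    semi_hilbert_space_axioms_def by blast

section \<open>Weighted direct sums\<close>

text \<open>A pair (f, h) becomes the single function \<open>case_sum f h\<close> on a disjoint
  union. The direct sum is then again a \<open>fun_space\<close>, to which the projection theorem
  applies.\<close>

definition dsum :: "real \<Rightarrow> 'a fun_space \<Rightarrow> 'b fun_space \<Rightarrow> ('a + 'b) fun_space" where
  "dsum \<beta> U V = \<lparr> vecs = {f. (\<lambda>x. f (Inl x)) \<in> vecs U \<and> (\<lambda>y. f (Inr y)) \<in> vecs V},
     cip = (\<lambda>f g. of_real \<beta> * cip U (\<lambda>x. f (Inl x)) (\<lambda>x. g (Inl x))
                  + cip V (\<lambda>y. f (Inr y)) (\<lambda>y. g (Inr y))) \<rparr>"

lemma vecs_dsum [simp]:
    "f \<in> vecs (dsum \<beta> U V) \<longleftrightarrow> (\<lambda>x. f (Inl x)) \<in> vecs U \<and> (\<lambda>y. f (Inr y)) \<in> vecs V"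
  and cip_dsum: "cip (dsum \<beta> U V) f g = of_real \<beta> * cip U (\<lambda>x. f (Inl x)) (\<lambda>x. g (Inl x))
                  + cip V (\<lambda>y. f (Inr y)) (\<lambda>y. g (Inr y))"
  by (simp_all add: dsum_def)

text \<open>Each component seminorm is at most a constant times the seminorm of the sum, with
  constant 1 / sqrt \<beta> for the first. Components of a Cauchy sequence are thus Cauchy, and
  their limits are glued by \<open>case_sum\<close>.\<close>

lemma semi_hilbert_space_dsum:
  assumes "semi_hilbert_space U" "semi_hilbert_space V" and \<beta>: "\<beta> > 0"
  shows "semi_hilbert_space (dsum \<beta> U V)"
proof -
  interpret U: semi_hilbert_space U by fact
  interpret V: semi_hilbert_space V by fact
  let ?W = "dsum \<beta> U V"
  have ip: "semi_inner_space ?W"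
  proof
    show "lin_subspace (vecs ?W)" by (simp add: lin_subspace_def)
    show "cip ?W g f = cnj (cip ?W f g)" if "f \<in> vecs ?W" "g \<in> vecs ?W" for f g
      using that U.cnj_cip[of "\<lambda>x. f (Inl x)" "\<lambda>x. g (Inl x)"]
        V.cnj_cip[of "\<lambda>x. f (Inr x)" "\<lambda>x. g (Inr x)"] by (simp add: cip_dsum)
  qed (use \<beta> in \<open>auto simp: cip_dsum U.cip_add_right V.cip_add_right U.cip_scale_right
        V.cip_scale_right U.Re_cip_nonneg V.Re_cip_nonneg algebra_simps\<close>)
  interpret W: semi_inner_space ?W by (rule ip)
  have sq: "(vnorm ?W f)\<^sup>2 = \<beta> * (vnorm U (\<lambda>x. f (Inl x)))\<^sup>2 + (vnorm V (\<lambda>x. f (Inr x)))\<^sup>2"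
    if "f \<in> vecs ?W" for f
    using that by (simp add: W.vnorm_power2 U.vnorm_power2 V.vnorm_power2 cip_dsum)
  have leU: "sqrt \<beta> * vnorm U (\<lambda>x. f (Inl x)) \<le> vnorm ?W f" if f: "f \<in> vecs ?W" for f
    by (rule power2_le_imp_le[OF _ W.vnorm_nonneg[OF f]])
      (use \<beta> in \<open>simp add: sq[OF f] power_mult_distrib\<close>)
  have leV: "vnorm V (\<lambda>x. f (Inr x)) \<le> vnorm ?W f" if f: "f \<in> vecs ?W" for f
    by (rule power2_le_imp_le[OF _ W.vnorm_nonneg[OF f]]) (use \<beta> in \<open>simp add: sq[OF f]\<close>)
  show ?thesis
  proof
    fix u assume u: "\<And>n. u n \<in> vecs ?W" and C: "cauchy_in ?W u"
    have "cauchy_in V (\<lambda>n x. u n (Inr x))"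
      unfolding cauchy_in_def
    proof (intro allI impI)
      fix e :: real assume "e > 0"
      then obtain N where N: "\<forall>m\<ge>N. \<forall>n\<ge>N. vnorm ?W (\<lambda>x. u m x - u n x) < e"
        using C unfolding cauchy_in_def by blast
      show "\<exists>N. \<forall>m\<ge>N. \<forall>n\<ge>N. vnorm V (\<lambda>x. u m (Inr x) - u n (Inr x)) < e"
        using N leV[of "\<lambda>x. u _ x - u _ x"] u W.diff_mem by (meson le_less_trans)
    qed
    then obtain h where h: "h \<in> vecs V" "conv_to V (\<lambda>n x. u n (Inr x)) h"
      using V.cauchy_imp_conv[of "\<lambda>n x. u n (Inr x)"] u by auto
    have "cauchy_in U (\<lambda>n x. u n (Inl x))"
      unfolding cauchy_in_def
    proof (intro allI impI)
      fix e :: real assume "e > 0"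
      then have "sqrt \<beta> * e > 0" using \<beta> by simp
      then obtain N where N: "\<forall>m\<ge>N. \<forall>n\<ge>N. vnorm ?W (\<lambda>x. u m x - u n x) < sqrt \<beta> * e"
        using C unfolding cauchy_in_def by blast
      show "\<exists>N. \<forall>m\<ge>N. \<forall>n\<ge>N. vnorm U (\<lambda>x. u m (Inl x) - u n (Inl x)) < e"
      proof (intro exI allI impI)
        fix m n assume "N \<le> m" "N \<le> n"
        then have "sqrt \<beta> * vnorm U (\<lambda>x. u m (Inl x) - u n (Inl x)) < sqrt \<beta> * e"
          using N leU[of "\<lambda>x. u m x - u n x"] u W.diff_mem by (meson le_less_trans)
        then show "vnorm U (\<lambda>x. u m (Inl x) - u n (Inl x)) < e" using \<beta> by simp
      qed
    qed
    then obtain f where f: "f \<in> vecs U" "conv_to U (\<lambda>n x. u n (Inl x)) f"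
      using U.cauchy_imp_conv[of "\<lambda>n x. u n (Inl x)"] u by auto
    have fh: "case_sum f h \<in> vecs ?W" using f h by simp
    have "(\<lambda>n. \<beta> * (vnorm U (\<lambda>x. u n (Inl x) - f x))\<^sup>2 + (vnorm V (\<lambda>x. u n (Inr x) - h x))\<^sup>2)
        \<longlonglongrightarrow> \<beta> * 0\<^sup>2 + 0\<^sup>2"
      using f h unfolding conv_to_def by (intro tendsto_intros)
    then have "(\<lambda>n. (vnorm ?W (\<lambda>x. u n x - case_sum f h x))\<^sup>2) \<longlonglongrightarrow> 0"
      using sq[OF W.diff_mem[OF u fh]] by simp
    from tendsto_real_sqrt[OF this] have "conv_to ?W u (case_sum f h)"
      using u fh W.vnorm_nonneg[OF W.diff_mem[OF u fh]] by (simp add: conv_to_def)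
    with fh show "\<exists>f\<in>vecs ?W. conv_to ?W u f" by blast
  qed
qed

section \<open>Regularised least squares for a closable operator\<close>

text \<open>Linearity is required of the graph, since \<open>T\<close> may relate \<open>f\<close>
  to many representatives of one value. Definiteness is asked of \<open>U\<close> alone because
  \<open>V\<close> will be L2.\<close>

locale closable_operator = U: semi_hilbert_space U + V: semi_hilbert_space V
  for U V :: "'a fun_space" +
  fixes T :: "'a linop"
  assumes definite: "f \<in> vecs U \<Longrightarrow> cip U f f = 0 \<Longrightarrow> f = (\<lambda>_. 0)"
    and graph_mem: "(f, h) \<in> T \<Longrightarrow> f \<in> vecs U \<and> h \<in> vecs V"
    and graph_zero: "((\<lambda>_. 0), (\<lambda>_. 0)) \<in> T"
    and graph_add: "(f, h) \<in> T \<Longrightarrow> (f', h') \<in> T \<Longrightarrow> ((\<lambda>x. f x + f' x), (\<lambda>x. h x + h' x)) \<in> T"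
    and graph_scale: "(f, h) \<in> T \<Longrightarrow> ((\<lambda>x. c * f x), (\<lambda>x. c * h x)) \<in> T"
    and closable: "closable U V T"
begin

definition S :: "'a linop" where "S = op_closure U V T"

lemma graph_diff: "(f, h) \<in> T \<Longrightarrow> (f', h') \<in> T \<Longrightarrow> ((\<lambda>x. f x - f' x), (\<lambda>x. h x - h' x)) \<in> T"
  using graph_add[of f h "\<lambda>x. (-1) * f' x" "\<lambda>x. (-1) * h' x"] graph_scale[of f' h' "-1"] by simp

lemma S_E:
  assumes "(f, h) \<in> S"
  obtains u v where "f \<in> vecs U" "h \<in> vecs V" "\<And>n. (u n, v n) \<in> T" "\<And>n. u n \<in> vecs U"
    "\<And>n. v n \<in> vecs V" "conv_to U u f" "conv_to V v h"
  using assms graph_mem unfolding S_def op_closure_def by blast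

lemma S_I:
  assumes "f \<in> vecs U" "h \<in> vecs V" "\<And>n. (u n, v n) \<in> T" "conv_to U u f" "conv_to V v h"
  shows "(f, h) \<in> S"
  using assms unfolding S_def op_closure_def by blast

lemma S_mem: "(f, h) \<in> S \<Longrightarrow> f \<in> vecs U" "(f, h) \<in> S \<Longrightarrow> h \<in> vecs V"
  by (auto simp: S_def op_closure_def)

lemma T_subset_S: "(f, h) \<in> T \<Longrightarrow> (f, h) \<in> S"
  using graph_mem by (intro S_I[where u = "\<lambda>_. f" and v = "\<lambda>_. h"])
    (auto intro: U.conv_to_const V.conv_to_const)

lemma S_diff:
  assumes "(f, h) \<in> S" "(f', h') \<in> S"
  shows "((\<lambda>x. f x - f' x), (\<lambda>x. h x - h' x)) \<in> S"
proof -
  obtain u v where 1: "f \<in> vecs U" "h \<in> vecs V" "\<And>n. (u n, v n) \<in> T" "\<And>n. u n \<in> vecs U"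
    "\<And>n. v n \<in> vecs V" "conv_to U u f" "conv_to V v h" by (rule S_E[OF assms(1)]) (rule that)
  obtain u' v' where 2: "f' \<in> vecs U" "h' \<in> vecs V" "\<And>n. (u' n, v' n) \<in> T" "\<And>n. u' n \<in> vecs U"
    "\<And>n. v' n \<in> vecs V" "conv_to U u' f'" "conv_to V v' h'" by (rule S_E[OF assms(2)]) (rule that)
  show ?thesis
    by (rule S_I[where u = "\<lambda>n x. u n x - u' n x" and v = "\<lambda>n x. v n x - v' n x"])
      (use 1 2 in \<open>auto intro: graph_diff U.conv_to_diff V.conv_to_diff\<close>)
qed

lemma S_zero: "((\<lambda>_. 0), h) \<in> S \<Longrightarrow> vnorm V h = 0"
  using closable by (simp add: closable_def S_def)

lemma S_single_valued: "(f, h) \<in> S \<Longrightarrow> (f, h') \<in> S \<Longrightarrow> vnorm V (\<lambda>x. h x - h' x) = 0"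
  using S_diff[of f h f h'] S_zero[of "\<lambda>x. h x - h' x"] by simp

lemma eq_if_vnorm_diff_zero:
  assumes "f \<in> vecs U" "g \<in> vecs U" "vnorm U (\<lambda>x. f x - g x) = 0"
  shows "f = g"
proof -
  have "(\<lambda>x. f x - g x) = (\<lambda>_. 0)"
    using assms by (intro definite) (simp_all add: U.cip_self)
  then show ?thesis by (auto simp: fun_eq_iff)
qed

text \<open>The equation says that (a, b) - (F, h) is orthogonal to the graph of \<open>S\<close> in
  the weighted sum. The projection is taken onto the graph of \<open>T\<close>. The approximating
  sequence, read componentwise, is exactly what membership in \<open>op_closure\<close> asks
  for.\<close>

lemma ex_graph_projection:
  fixes \<beta> :: real
  assumes \<beta>: "\<beta> > 0" and a: "a \<in> vecs U" and b: "b \<in> vecs V"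
  obtains F h where "(F, h) \<in> S"
    "\<And>f k. (f, k) \<in> S \<Longrightarrow> complex_of_real \<beta> * cip U f (\<lambda>x. a x - F x) + cip V k (\<lambda>x. b x - h x) = 0"
proof -
  interpret W: semi_hilbert_space "dsum \<beta> U V"
    by (rule semi_hilbert_space_dsum) (unfold_locales, fact)
  define G where "G = (\<lambda>(f, h). case_sum f h) ` T"
  have mem_G: "w \<in> G \<longleftrightarrow> ((\<lambda>x. w (Inl x)), (\<lambda>x. w (Inr x))) \<in> T" for w
  proof
    assume "w \<in> G" then show "((\<lambda>x. w (Inl x)), (\<lambda>x. w (Inr x))) \<in> T" by (auto simp: G_def)
  next
    assume "((\<lambda>x. w (Inl x)), (\<lambda>x. w (Inr x))) \<in> T"
    moreover have "w = case_sum (\<lambda>x. w (Inl x)) (\<lambda>x. w (Inr x))"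
      by (auto simp: fun_eq_iff split: sum.split)
    ultimately show "w \<in> G" unfolding G_def by (auto intro!: image_eqI[rotated])
  qed
  have "lin_subspace G"
    by (auto simp: lin_subspace_def mem_G intro: graph_zero graph_add graph_scale)
  moreover have "G \<subseteq> vecs (dsum \<beta> U V)" using graph_mem by (auto simp: mem_G)
  moreover have "case_sum a b \<in> vecs (dsum \<beta> U V)" using a b by simp
  ultimately obtain p u where p: "p \<in> vecs (dsum \<beta> U V)" and u: "\<And>n. u n \<in> G"
    and up: "conv_to (dsum \<beta> U V) u p"
    and orth: "\<And>g. g \<in> G \<Longrightarrow> cip (dsum \<beta> U V) g (\<lambda>x. case_sum a b x - p x) = 0"
    by (rule W.ex_projection) (rule that)
  define F h where "F = (\<lambda>x. p (Inl x))" and "h = (\<lambda>x. p (Inr x))"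
  have FV: "F \<in> vecs U" "h \<in> vecs V" using p by (simp_all add: F_def h_def)
  have uT: "((\<lambda>x. u n (Inl x)), (\<lambda>x. u n (Inr x))) \<in> T" for n using u by (simp add: mem_G)
  have uV: "(\<lambda>x. u n (Inl x)) \<in> vecs U" "(\<lambda>x. u n (Inr x)) \<in> vecs V" for n
    using uT graph_mem by blast+
  have sq: "(vnorm (dsum \<beta> U V) (\<lambda>x. u n x - p x))\<^sup>2
      = \<beta> * (vnorm U (\<lambda>x. u n (Inl x) - F x))\<^sup>2 + (vnorm V (\<lambda>x. u n (Inr x) - h x))\<^sup>2" for n
  proof -
    have "(\<lambda>x. u n x - p x) \<in> vecs (dsum \<beta> U V)" using p uV by (intro W.diff_mem) auto
    then show ?thesis using FV uV[of n]
      by (simp add: W.vnorm_power2 U.vnorm_power2 V.vnorm_power2 cip_dsum F_def h_def)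
  qed
  have lim: "(\<lambda>n. (vnorm (dsum \<beta> U V) (\<lambda>x. u n x - p x))\<^sup>2) \<longlonglongrightarrow> 0"
    using tendsto_power[OF up[unfolded conv_to_def], of 2] by simp
  have "(\<lambda>n. (vnorm V (\<lambda>x. u n (Inr x) - h x))\<^sup>2) \<longlonglongrightarrow> 0"
    by (rule tendsto_sandwich[OF _ _ tendsto_const lim]) (use \<beta> in \<open>simp_all add: sq\<close>)
  from tendsto_real_sqrt[OF this] have cV: "conv_to V (\<lambda>n x. u n (Inr x)) h"
    using FV uV by (simp add: conv_to_def)
  have "(\<lambda>n. \<beta> * (vnorm U (\<lambda>x. u n (Inl x) - F x))\<^sup>2) \<longlonglongrightarrow> 0"
    by (rule tendsto_sandwich[OF _ _ tendsto_const lim]) (use \<beta> in \<open>simp_all add: sq\<close>)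
  from tendsto_mult_left[OF this, of "1 / \<beta>"]
  have "(\<lambda>n. (vnorm U (\<lambda>x. u n (Inl x) - F x))\<^sup>2) \<longlonglongrightarrow> 0" using \<beta> by simp
  from tendsto_real_sqrt[OF this] have cU: "conv_to U (\<lambda>n x. u n (Inl x)) F"
    using FV uV by (simp add: conv_to_def)
  have FS: "(F, h) \<in> S" by (rule S_I[OF FV uT cU cV])
  have orth_T: "complex_of_real \<beta> * cip U f (\<lambda>x. a x - F x) + cip V k (\<lambda>x. b x - h x) = 0" if "(f, k) \<in> T" for f k
    using orth[of "case_sum f k"] that by (simp add: mem_G cip_dsum F_def h_def)
  \<comment> \<open>Orthogonality extends from \<open>T\<close> to its closure by continuity of both
    inner products in the first argument.\<close>
  have "complex_of_real \<beta> * cip U f (\<lambda>x. a x - F x) + cip V k (\<lambda>x. b x - h x) = 0" if fk: "(f, k) \<in> S" for f k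
  proof -
    obtain u v where 1: "f \<in> vecs U" "k \<in> vecs V" "\<And>n. (u n, v n) \<in> T" "\<And>n. u n \<in> vecs U"
      "\<And>n. v n \<in> vecs V" "conv_to U u f" "conv_to V v k" by (rule S_E[OF fk]) (rule that)
    have "(\<lambda>n. complex_of_real \<beta> * cip U (u n) (\<lambda>x. a x - F x) + cip V (v n) (\<lambda>x. b x - h x))
        \<longlonglongrightarrow> complex_of_real \<beta> * cip U f (\<lambda>x. a x - F x) + cip V k (\<lambda>x. b x - h x)"
      using a b FV 1 by (intro tendsto_intros U.conv_to_cip_left V.conv_to_cip_left) auto
    then show ?thesis using orth_T[OF 1(3)] by (simp add: LIMSEQ_const_iff)
  qed
  with FS show ?thesis by (rule that)
qed

section \<open>The adjoint of the closure and the weak normal equation\<close>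

lemma adjoint_iff:
  "(\<psi>, g) \<in> adjoint_op U V S \<longleftrightarrow>
    \<psi> \<in> vecs V \<and> g \<in> vecs U \<and> (\<forall>f h. (f, h) \<in> S \<longrightarrow> cip U f g = cip V h \<psi>)"
  by (auto simp: adjoint_op_def)

lemma adjoint_diff:
  assumes "(\<psi>, g) \<in> adjoint_op U V S" "(\<psi>', g') \<in> adjoint_op U V S"
  shows "((\<lambda>x. \<psi> x - \<psi>' x), (\<lambda>x. g x - g' x)) \<in> adjoint_op U V S"
  using assms by (auto simp: adjoint_iff U.cip_diff_right V.cip_diff_right S_mem)

lemma adjoint_scale:
  assumes "(\<psi>, g) \<in> adjoint_op U V S"
  shows "((\<lambda>x. c * \<psi> x), (\<lambda>x. c * g x)) \<in> adjoint_op U V S"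
  using assms by (auto simp: adjoint_iff U.cip_scale_right V.cip_scale_right S_mem)

lemma lin_subspace_Domain_adjoint: "lin_subspace (Domain (adjoint_op U V S))"
proof -
  have "((\<lambda>_. 0), (\<lambda>_. 0)) \<in> adjoint_op U V S"
    by (auto simp: adjoint_iff S_mem)
  moreover have "((\<lambda>x. \<psi> x + \<psi>' x), (\<lambda>x. g x + g' x)) \<in> adjoint_op U V S"
    if "(\<psi>, g) \<in> adjoint_op U V S" "(\<psi>', g') \<in> adjoint_op U V S" for \<psi> \<psi>' g g'
    using adjoint_diff[OF that(1) adjoint_scale[OF that(2), of "-1"]] by simp
  ultimately show ?thesis
    unfolding lin_subspace_def by (blast intro: adjoint_scale)
qed

text \<open>The normal equation in a form that also makes sense for \<open>\<psi>\<close> outside the domain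
  of the adjoint.\<close>

definition weak_solution :: "real \<Rightarrow> ('a \<Rightarrow> complex) \<Rightarrow> ('a \<Rightarrow> complex) \<Rightarrow> ('a \<Rightarrow> complex) \<Rightarrow> bool" where
  "weak_solution \<beta> \<psi> F h \<longleftrightarrow> \<psi> \<in> vecs V \<and> (F, h) \<in> S \<and>
     ((\<lambda>x. \<psi> x - h x), (\<lambda>x. of_real \<beta> * F x)) \<in> adjoint_op U V S"

lemma ex_weak_solution:
  assumes \<beta>: "\<beta> > 0" and \<psi>: "\<psi> \<in> vecs V"
  obtains F h where "weak_solution \<beta> \<psi> F h"
proof -
  obtain F h where 1: "(F, h) \<in> S" and
    2: "\<And>f k. (f, k) \<in> S \<Longrightarrow> complex_of_real \<beta> * cip U f (\<lambda>x. 0 - F x) + cip V k (\<lambda>x. \<psi> x - h x) = 0"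
    by (rule ex_graph_projection[OF \<beta> U.zero_mem \<psi>]) (rule that)
  have "cip U f (\<lambda>x. of_real \<beta> * F x) = cip V k (\<lambda>x. \<psi> x - h x)" if "(f, k) \<in> S" for f k
    using 2[OF that] S_mem[OF 1] S_mem[OF that] U.cip_diff_right[of f "\<lambda>_. 0" F]
    by (simp add: U.cip_scale_right)
  then have "weak_solution \<beta> \<psi> F h"
    using S_mem[OF 1] 1 \<psi> by (simp add: weak_solution_def adjoint_iff)
  then show ?thesis by (rule that)
qed

lemma weak_solution_diff:
  assumes "weak_solution \<beta> \<psi> F h" "weak_solution \<beta> \<psi>' F' h'"
  shows "weak_solution \<beta> (\<lambda>x. \<psi> x - \<psi>' x) (\<lambda>x. F x - F' x) (\<lambda>x. h x - h' x)"
proof -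
  have "((\<lambda>x. \<psi> x - h x - (\<psi>' x - h' x)), (\<lambda>x. of_real \<beta> * F x - of_real \<beta> * F' x)) \<in> adjoint_op U V S"
    by (rule adjoint_diff) (use assms in \<open>auto simp: weak_solution_def\<close>)
  then show ?thesis using assms
    by (simp add: weak_solution_def S_diff algebra_simps)
qed

text \<open>Testing the adjoint relation with \<open>F\<close> itself gives \<beta>
  \<parallel>F\<parallel>^2 = Re \<langle>\<psi>, h\<rangle> - \<parallel>h\<parallel>^2, and
  \<parallel>\<psi> - h\<parallel>^2 \<ge> 0 controls the mixed term. Applied to differences, the
  bound yields uniqueness as well as continuous dependence on \<psi>.\<close>

lemma weak_solution_bound:
  assumes "weak_solution \<beta> \<psi> F h"
  shows "\<beta> * (vnorm U F)\<^sup>2 \<le> (vnorm V \<psi>)\<^sup>2"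
proof -
  have S: "(F, h) \<in> S" and \<psi>: "\<psi> \<in> vecs V" and F: "F \<in> vecs U" and h: "h \<in> vecs V"
    using assms S_mem by (auto simp: weak_solution_def)
  have "cip U F (\<lambda>x. of_real \<beta> * F x) = cip V h (\<lambda>x. \<psi> x - h x)"
    using assms S by (auto simp: weak_solution_def adjoint_iff)
  then have "of_real \<beta> * cip U F F = cip V h \<psi> - cip V h h"
    using F h \<psi> by (simp add: U.cip_scale_right V.cip_diff_right)
  from arg_cong[OF this, of Re]
  have "\<beta> * (vnorm U F)\<^sup>2 = Re (cip V \<psi> h) - (vnorm V h)\<^sup>2"
    using F h \<psi> V.Re_cip_commute[OF h \<psi>] by (simp add: U.vnorm_power2 V.vnorm_power2)
  also have "\<dots> \<le> (vnorm V \<psi>)\<^sup>2"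
    using zero_le_power2[of "vnorm V (\<lambda>x. \<psi> x - h x)"] zero_le_power2[of "vnorm V \<psi>"]
      zero_le_power2[of "vnorm V h"]
    unfolding V.vnorm_diff_power2[OF \<psi> h] by linarith
  finally show ?thesis .
qed

lemma weak_solution_unique:
  assumes "\<beta> > 0" "weak_solution \<beta> \<psi> F h" "weak_solution \<beta> \<psi> F' h'"
  shows "F = F'"
proof -
  have "\<beta> * (vnorm U (\<lambda>x. F x - F' x))\<^sup>2 \<le> 0"
    using weak_solution_bound[OF weak_solution_diff[OF assms(2,3)]] by simp
  then have "vnorm U (\<lambda>x. F x - F' x) = 0" using assms(1) by (simp add: mult_le_0_iff)
  then show ?thesis using assms S_mem
    by (intro eq_if_vnorm_diff_zero) (auto simp: weak_solution_def)
qed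

section \<open>The normal operator and the solution operator\<close>

lemma normal_op_iff:
  "(f, g) \<in> normal_op U V \<beta> S \<longleftrightarrow>
    (\<exists>h. (f, h) \<in> S \<and> g \<in> vecs U \<and> (h, (\<lambda>x. g x - of_real \<beta> * f x)) \<in> adjoint_op U V S)"
proof
  assume "(f, g) \<in> normal_op U V \<beta> S"
  then obtain h g' where "(f, h) \<in> S" "(h, g') \<in> adjoint_op U V S"
    "g = (\<lambda>x. of_real \<beta> * f x + g' x)"
    by (auto simp: normal_op_def shift_op_def)
  then show "\<exists>h. (f, h) \<in> S \<and> g \<in> vecs U \<and> (h, (\<lambda>x. g x - of_real \<beta> * f x)) \<in> adjoint_op U V S"
    by (auto simp: S_mem adjoint_iff intro!: exI[of _ h])
next
  assume "\<exists>h. (f, h) \<in> S \<and> g \<in> vecs U \<and> (h, (\<lambda>x. g x - of_real \<beta> * f x)) \<in> adjoint_op U V S"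
  then show "(f, g) \<in> normal_op U V \<beta> S"
    unfolding normal_op_def shift_op_def by (force simp: algebra_simps)
qed

lemma ex1_normal_op:
  assumes \<beta>: "\<beta> > 0" and g: "g \<in> vecs U"
  shows "\<exists>!f. (f, g) \<in> normal_op U V \<beta> S"
proof (rule ex_ex1I)
  \<comment> \<open>The division cancels the weight \<beta> that the direct sum puts on the first
    component.\<close>
  define g' where "g' = (\<lambda>x. (1 / of_real \<beta>) * g x)"
  have g': "g' \<in> vecs U" unfolding g'_def using g by (rule U.scale_mem)
  obtain F h where 1: "(F, h) \<in> S" and
    2: "\<And>f k. (f, k) \<in> S \<Longrightarrow>
      complex_of_real \<beta> * cip U f (\<lambda>x. g' x - F x) + cip V k (\<lambda>x. 0 - h x) = 0"
    by (rule ex_graph_projection[OF \<beta> g' V.zero_mem]) (rule that)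
  have "cip U f (\<lambda>x. g x - of_real \<beta> * F x) = cip V k h" if "(f, k) \<in> S" for f k
  proof -
    note m = S_mem[OF 1] S_mem[OF that] g g'
    have "of_real \<beta> * cip U f g' = cip U f g"
      unfolding g'_def using U.cip_scale_right[of f g "1 / of_real \<beta>"] m \<beta> by simp
    then show ?thesis
      using 2[OF that] V.cip_diff_right[of k "\<lambda>_. 0" h] m
      by (simp add: U.cip_scale_right U.cip_diff_right right_diff_distrib)
  qed
  then have "(h, (\<lambda>x. g x - of_real \<beta> * F x)) \<in> adjoint_op U V S"
    using S_mem[OF 1] g by (simp add: adjoint_iff)
  with 1 g show "\<exists>f. (f, g) \<in> normal_op U V \<beta> S" by (auto simp: normal_op_iff)
next
  fix f f' assume "(f, g) \<in> normal_op U V \<beta> S" "(f', g) \<in> normal_op U V \<beta> S"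
  then obtain h h' where h: "(f, h) \<in> S" "(f', h') \<in> S"
    "(h, (\<lambda>x. g x - of_real \<beta> * f x)) \<in> adjoint_op U V S"
    "(h', (\<lambda>x. g x - of_real \<beta> * f' x)) \<in> adjoint_op U V S" by (auto simp: normal_op_iff)
  \<comment> \<open>The difference of two solutions is a weak solution with data 0, hence equal to
    the trivial one.\<close>
  have "((\<lambda>x. 0 - (h x - h' x)), (\<lambda>x. of_real \<beta> * (f x - f' x))) \<in> adjoint_op U V S"
    using adjoint_diff[OF h(4,3)] by (simp add: algebra_simps)
  then have "weak_solution \<beta> (\<lambda>_. 0) (\<lambda>x. f x - f' x) (\<lambda>x. h x - h' x)"
    using S_diff[OF h(1,2)] by (simp add: weak_solution_def)
  moreover have "((\<lambda>_. 0), (\<lambda>_. 0)) \<in> S" by (rule T_subset_S[OF graph_zero])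
  then have "weak_solution \<beta> (\<lambda>_. 0) (\<lambda>_. 0) (\<lambda>_. 0)"
    by (auto simp: weak_solution_def adjoint_iff S_mem)
  ultimately have "(\<lambda>x. f x - f' x) = (\<lambda>_. 0)" by (rule weak_solution_unique[OF \<beta>])
  then show "f = f'" by (auto simp: fun_eq_iff)
qed

text \<open>When \<open>S\<^sup>* \<psi>\<close> exists,
  \<open>S\<^sup>* \<psi> = \<beta> F + S\<^sup>* h\<close> and
  \<open>S\<^sup>* (\<psi> - h) = \<beta> F\<close> are equivalent by linearity of the
  adjoint.\<close>

lemma solution_op_iff:
  "(\<psi>, F) \<in> solution_op U V \<beta> S \<longleftrightarrow>
    \<psi> \<in> Domain (adjoint_op U V S) \<and> (\<exists>h. weak_solution \<beta> \<psi> F h)"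
proof
  assume "(\<psi>, F) \<in> solution_op U V \<beta> S"
  then obtain g h where 1: "(\<psi>, g) \<in> adjoint_op U V S" "(F, h) \<in> S"
    "(h, (\<lambda>x. g x - of_real \<beta> * F x)) \<in> adjoint_op U V S"
    by (auto simp: solution_op_def normal_op_iff)
  from adjoint_diff[OF 1(1,3)] have "weak_solution \<beta> \<psi> F h"
    using 1 by (simp add: weak_solution_def adjoint_iff)
  with 1 show "\<psi> \<in> Domain (adjoint_op U V S) \<and> (\<exists>h. weak_solution \<beta> \<psi> F h)" by blast
next
  assume "\<psi> \<in> Domain (adjoint_op U V S) \<and> (\<exists>h. weak_solution \<beta> \<psi> F h)"
  then obtain g h where 1: "(\<psi>, g) \<in> adjoint_op U V S" "weak_solution \<beta> \<psi> F h" by blast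
  from adjoint_diff[OF 1(1), of "\<lambda>x. \<psi> x - h x" "\<lambda>x. of_real \<beta> * F x"] 1(2)
  have "(h, (\<lambda>x. g x - of_real \<beta> * F x)) \<in> adjoint_op U V S" "(F, h) \<in> S"
    by (simp_all add: weak_solution_def)
  then have "(F, g) \<in> normal_op U V \<beta> S"
    using 1(1) by (auto simp: normal_op_iff adjoint_iff)
  with 1(1) show "(\<psi>, F) \<in> solution_op U V \<beta> S"
    by (auto simp: solution_op_def)
qed

text \<open>If \<open>w\<close> is orthogonal to the domain of \<open>S\<^sup>*\<close>, its weak solution for \<open>\<beta> = 1\<close> satisfies
  \<open>\<parallel>w - h\<parallel>\<^sup>2 = - \<parallel>F\<parallel>\<^sup>2\<close>. Hence \<open>F = 0\<close> and \<open>w = h\<close>, which is null by closability.\<close>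

lemma adjoint_densely_defined:
  assumes \<psi>: "\<psi> \<in> vecs V"
  obtains u where "\<And>n. u n \<in> Domain (adjoint_op U V S)" "conv_to V u \<psi>"
proof -
  have sub: "Domain (adjoint_op U V S) \<subseteq> vecs V" by (auto simp: adjoint_iff)
  obtain p u where p: "p \<in> vecs V" and u: "\<And>n. u n \<in> Domain (adjoint_op U V S)"
    and up: "conv_to V u p"
    and orth: "\<And>g. g \<in> Domain (adjoint_op U V S) \<Longrightarrow> cip V g (\<lambda>x. \<psi> x - p x) = 0"
    by (rule V.ex_projection[OF lin_subspace_Domain_adjoint sub \<psi>]) (rule that)
  define w where "w = (\<lambda>x. \<psi> x - p x)"
  have w: "w \<in> vecs V" using p \<psi> by (simp add: w_def)
  obtain F h where Fh: "weak_solution 1 w F h" using ex_weak_solution[OF zero_less_one w] by blast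
  then have S: "(F, h) \<in> S" and adj: "((\<lambda>x. w x - h x), F) \<in> adjoint_op U V S"
    by (auto simp: weak_solution_def)
  note FV = S_mem[OF S]
  \<comment> \<open>The weak equation places \<open>w - h\<close> in the domain of the adjoint, to
    which \<open>w\<close> is orthogonal.\<close>
  have "cip V (\<lambda>x. w x - h x) w = 0" using orth adj unfolding w_def by blast
  then have 1: "(vnorm V w)\<^sup>2 = Re (cip V h w)"
    using FV w by (simp add: V.cip_diff_left V.vnorm_power2)
  have "cip U F F = cip V h (\<lambda>x. w x - h x)" using S adj by (auto simp: adjoint_iff)
  then have 2: "(vnorm U F)\<^sup>2 = Re (cip V h w) - (vnorm V h)\<^sup>2"
    using FV w by (simp add: V.cip_diff_right V.vnorm_power2 U.vnorm_power2)
  have "(vnorm V (\<lambda>x. h x - w x))\<^sup>2 = - (vnorm U F)\<^sup>2"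
    using 1 2 FV w by (simp add: V.vnorm_diff_power2)
  then have "vnorm U F = 0" and hw: "vnorm V (\<lambda>x. h x - w x) = 0"
    using zero_le_power2[of "vnorm V (\<lambda>x. h x - w x)"] zero_le_power2[of "vnorm U F"]
    by (metis neg_0_le_iff_le order_antisym power_eq_0_iff neg_equal_0_iff_equal)+
  then have "F = (\<lambda>_. 0)" using FV by (intro definite) (simp_all add: U.cip_self)
  then have "vnorm V h = 0" using S S_zero by simp
  then have "vnorm V w = 0" using hw V.vnorm_diff_le[OF FV(2) w] by simp
  have uV: "\<And>n. u n \<in> vecs V" using u sub by blast
  \<comment> \<open>\<open>p\<close> and \<psi> may differ as functions, but their difference
    \<open>w\<close> is null, so a sequence converging to one converges to the other.\<close>
  have "conv_to V u \<psi>"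
    unfolding conv_to_def
  proof (rule tendsto_sandwich[OF _ _ tendsto_const up[unfolded conv_to_def]])
    show "\<forall>\<^sub>F n in sequentially. vnorm V (\<lambda>x. u n x - \<psi> x) \<le> vnorm V (\<lambda>x. u n x - p x)"
      using V.vnorm_triangle[of "u _" p \<psi>] uV p \<psi> \<open>vnorm V w = 0\<close> V.vnorm_minus_commute[of p \<psi>]
      by (auto simp: w_def)
  qed (use uV \<psi> in auto)
  with u show ?thesis by (rule that)
qed

text \<open>By \<open>weak_solution_bound\<close>, solutions converge whenever their data do. Hence
  a limit of solutions can only be \<open>F\<close>. Conversely, density of the domain of the
  adjoint supplies data converging to \<psi> whose solutions belong to
  \<open>solution_op\<close>.\<close>

lemma closure_solution_op_iff:
  assumes \<beta>: "\<beta> > 0" and F: "weak_solution \<beta> \<psi> F h"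
  shows "(\<psi>, G) \<in> op_closure V U (solution_op U V \<beta> S) \<longleftrightarrow> G = F"
proof -
  have \<psi>: "\<psi> \<in> vecs V" and FU: "F \<in> vecs U" using F S_mem by (auto simp: weak_solution_def)
  have conv: "conv_to U v F" if sol: "\<And>n. \<exists>k. weak_solution \<beta> (u n) (v n) k" and u: "conv_to V u \<psi>" for u v
  proof -
    obtain k where k: "\<And>n. weak_solution \<beta> (u n) (v n) (k n)" using sol by metis
    have vU: "v n \<in> vecs U" and uV: "u n \<in> vecs V" for n
      using k[of n] S_mem by (auto simp: weak_solution_def)
    have "(vnorm U (\<lambda>x. v n x - F x))\<^sup>2 \<le> (vnorm V (\<lambda>x. u n x - \<psi> x))\<^sup>2 / \<beta>" for n
      using weak_solution_bound[OF weak_solution_diff[OF k F]] \<beta> by (simp add: field_simps)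
    then have le: "\<forall>\<^sub>F n in sequentially.
        (vnorm U (\<lambda>x. v n x - F x))\<^sup>2 \<le> (vnorm V (\<lambda>x. u n x - \<psi> x))\<^sup>2 / \<beta>"
      by (intro always_eventually allI)
    have "(\<lambda>n. (vnorm V (\<lambda>x. u n x - \<psi> x))\<^sup>2 / \<beta>) \<longlonglongrightarrow> 0\<^sup>2 / \<beta>"
      using u \<beta> unfolding conv_to_def by (intro tendsto_intros) auto
    then have lim: "(\<lambda>n. (vnorm V (\<lambda>x. u n x - \<psi> x))\<^sup>2 / \<beta>) \<longlonglongrightarrow> 0" by simp
    have "(\<lambda>n. (vnorm U (\<lambda>x. v n x - F x))\<^sup>2) \<longlonglongrightarrow> 0"
      by (rule tendsto_sandwich[OF _ le tendsto_const lim]) simp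
    from tendsto_real_sqrt[OF this] show ?thesis using vU FU by (simp add: conv_to_def)
  qed
  show ?thesis
  proof
    assume "(\<psi>, G) \<in> op_closure V U (solution_op U V \<beta> S)"
    then obtain u v where G: "G \<in> vecs U" "conv_to U v G" and u: "conv_to V u \<psi>"
      and sol: "\<And>n. (u n, v n) \<in> solution_op U V \<beta> S"
      by (auto simp: op_closure_def)
    have vU: "v n \<in> vecs U" for n
      using sol[of n] S_mem by (auto simp: solution_op_iff weak_solution_def)
    have "conv_to U v F" using sol u by (intro conv) (auto simp: solution_op_iff)
    then show "G = F" using G vU FU by (intro eq_if_vnorm_diff_zero U.conv_to_unique[of v])
  next
    assume "G = F"
    obtain u where u: "\<And>n. u n \<in> Domain (adjoint_op U V S)" "conv_to V u \<psi>"
      by (rule adjoint_densely_defined[OF \<psi>]) (rule that)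
    then have "u n \<in> vecs V" for n by (meson DomainE adjoint_iff)
    then have "\<forall>n. \<exists>f k. weak_solution \<beta> (u n) f k" using ex_weak_solution[OF \<beta>] by metis
    then obtain v where v: "\<And>n. \<exists>k. weak_solution \<beta> (u n) (v n) k" by metis
    with u have "(u n, v n) \<in> solution_op U V \<beta> S" for n by (simp add: solution_op_iff)
    with u conv[OF v u(2)] \<psi> FU show "(\<psi>, G) \<in> op_closure V U (solution_op U V \<beta> S)"
      unfolding \<open>G = F\<close> op_closure_def by blast
  qed
qed

section \<open>Minimising the functional\<close>

text \<open>The operator value \<open>h\<close> is an explicit argument here, which keeps the choice
  and the value \<infinity> in \<open>tikhonov\<close> out of the computations.\<close>

definition Q :: "real \<Rightarrow> ('a \<Rightarrow> complex) \<Rightarrow> ('a \<Rightarrow> complex) \<Rightarrow> ('a \<Rightarrow> complex) \<Rightarrow> real" where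
  "Q \<beta> \<psi> f h = (vnorm V (\<lambda>x. \<psi> x - h x))\<^sup>2 + \<beta> * (vnorm U f)\<^sup>2"

text \<open>Any two values of \<open>S\<close> at the same point differ by a null function, by
  closability, so the choice made in \<open>tikhonov\<close> does not affect the norm. The
  intermediate relation \<open>R\<close> lets this serve both \<open>T\<close> and
  \<open>S\<close>.\<close>

lemma tikhonov_eq:
  assumes \<psi>: "\<psi> \<in> vecs V" and R: "R \<subseteq> S" and fh: "(f, h) \<in> R"
  shows "tikhonov U V \<beta> \<psi> R f = ereal (Q \<beta> \<psi> f h)"
proof -
  define h' where "h' = (SOME h. (f, h) \<in> R)"
  have "(f, h') \<in> R" unfolding h'_def using someI[of "\<lambda>h. (f, h) \<in> R", OF fh] .
  then have S: "(f, h') \<in> S" "(f, h) \<in> S" using R fh by auto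
  note h = S_mem(2)[OF S(1)] S_mem(2)[OF S(2)]
  have "(\<lambda>x. \<psi> x - h' x - (\<psi> x - h x)) = (\<lambda>x. h x - h' x)" by auto
  then have "vnorm V (\<lambda>x. \<psi> x - h' x) = vnorm V (\<lambda>x. \<psi> x - h x)"
    using V.vnorm_diff_le[of "\<lambda>x. \<psi> x - h' x" "\<lambda>x. \<psi> x - h x"] S_single_valued[OF S(2,1)] \<psi> h
    by simp
  then show ?thesis using fh by (auto simp: tikhonov_def h'_def[symmetric] Q_def)
qed

text \<open>Expand along \<psi> - k = (\<psi> - h) + (h - k) and f = F - (F - f). The two mixed
  terms cancel, because (F - f, h - k) lies in \<open>S\<close> and may be tested in the adjoint
  relation for \<open>F\<close>.\<close>

lemma Q_weak_solution:
  assumes F: "weak_solution \<beta> \<psi> F h" and fk: "(f, k) \<in> S"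
  shows "Q \<beta> \<psi> f k = Q \<beta> \<psi> F h + (vnorm V (\<lambda>x. h x - k x))\<^sup>2 + \<beta> * (vnorm U (\<lambda>x. F x - f x))\<^sup>2"
proof -
  have S: "(F, h) \<in> S" and \<psi>: "\<psi> \<in> vecs V" using F by (auto simp: weak_solution_def)
  note m = S_mem[OF S] S_mem[OF fk] \<psi>
  have "cip U (\<lambda>x. F x - f x) (\<lambda>x. of_real \<beta> * F x) = cip V (\<lambda>x. h x - k x) (\<lambda>x. \<psi> x - h x)"
    using F S_diff[OF S fk] by (auto simp: weak_solution_def adjoint_iff)
  then have "of_real \<beta> * cip U (\<lambda>x. F x - f x) F = cip V (\<lambda>x. h x - k x) (\<lambda>x. \<psi> x - h x)"
    using m by (simp add: U.cip_scale_right)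
  from arg_cong[OF this, of Re]
  have orth: "\<beta> * Re (cip U F (\<lambda>x. F x - f x)) = Re (cip V (\<lambda>x. \<psi> x - h x) (\<lambda>x. h x - k x))"
    using m U.Re_cip_commute[of F "\<lambda>x. F x - f x"]
      V.Re_cip_commute[of "\<lambda>x. \<psi> x - h x" "\<lambda>x. h x - k x"] by simp
  have 1: "(vnorm V (\<lambda>x. \<psi> x - k x))\<^sup>2 = (vnorm V (\<lambda>x. \<psi> x - h x))\<^sup>2
      + 2 * Re (cip V (\<lambda>x. \<psi> x - h x) (\<lambda>x. h x - k x)) + (vnorm V (\<lambda>x. h x - k x))\<^sup>2"
    using V.vnorm_add_power2[of "\<lambda>x. \<psi> x - h x" "\<lambda>x. h x - k x"] m by simp
  have 2: "(vnorm U f)\<^sup>2 = (vnorm U F)\<^sup>2 - 2 * Re (cip U F (\<lambda>x. F x - f x)) + (vnorm U (\<lambda>x. F x - f x))\<^sup>2"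
    using U.vnorm_diff_power2[of F "\<lambda>x. F x - f x"] m by simp
  show ?thesis unfolding Q_def 1 2 orth[symmetric] by (simp add: algebra_simps)
qed

text \<open>\<open>F\<close> may lie outside the domain of \<open>R\<close>, so the upper bound is a
  limit of values along a sequence in the graph of \<open>T\<close> converging to (F, h). The lower
  bound is Pythagoras.\<close>

lemma INF_tikhonov:
  assumes \<beta>: "\<beta> > 0" and F: "weak_solution \<beta> \<psi> F h" and R: "T \<subseteq> R" "R \<subseteq> S"
  shows "(INF f\<in>vecs U. tikhonov U V \<beta> \<psi> R f) = ereal (Q \<beta> \<psi> F h)"
proof (rule antisym)
  have S: "(F, h) \<in> S" and \<psi>: "\<psi> \<in> vecs V" using F by (auto simp: weak_solution_def)
  obtain u v where uv: "F \<in> vecs U" "h \<in> vecs V" "\<And>n. (u n, v n) \<in> T" "\<And>n. u n \<in> vecs U"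
    "\<And>n. v n \<in> vecs V" "conv_to U u F" "conv_to V v h" by (rule S_E[OF S]) (rule that)
  have "(\<lambda>n. Q \<beta> \<psi> (u n) (v n)) \<longlonglongrightarrow> Q \<beta> \<psi> F h"
    unfolding Q_def using uv \<psi>
    by (intro tendsto_intros U.conv_to_vnorm V.conv_to_vnorm V.conv_to_diff V.conv_to_const) auto
  then have lim: "(\<lambda>n. ereal (Q \<beta> \<psi> (u n) (v n))) \<longlonglongrightarrow> ereal (Q \<beta> \<psi> F h)" by simp
  have le: "(INF f\<in>vecs U. tikhonov U V \<beta> \<psi> R f) \<le> ereal (Q \<beta> \<psi> (u n) (v n))" for n
    using tikhonov_eq[OF \<psi> R(2), of "u n" "v n"] uv R(1) by (metis INF_lower subsetD)
  show "(INF f\<in>vecs U. tikhonov U V \<beta> \<psi> R f) \<le> ereal (Q \<beta> \<psi> F h)"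
    by (rule LIMSEQ_le_const[OF lim]) (use le in blast)
  show "ereal (Q \<beta> \<psi> F h) \<le> (INF f\<in>vecs U. tikhonov U V \<beta> \<psi> R f)"
  proof (rule INF_greatest)
    fix f assume "f \<in> vecs U"
    show "ereal (Q \<beta> \<psi> F h) \<le> tikhonov U V \<beta> \<psi> R f"
    proof (cases "f \<in> Domain R")
      case True
      then obtain k where k: "(f, k) \<in> R" by blast
      have "Q \<beta> \<psi> F h \<le> Q \<beta> \<psi> f k" using Q_weak_solution[OF F] k R \<beta> by auto
      then show ?thesis using tikhonov_eq[OF \<psi> R(2) k] by simp
    qed (simp add: tikhonov_def)
  qed
qed

lemma tikhonov_minimal_iff:
  assumes \<beta>: "\<beta> > 0" and F: "weak_solution \<beta> \<psi> F h"
  shows "tikhonov U V \<beta> \<psi> S G = ereal (Q \<beta> \<psi> F h) \<longleftrightarrow> G = F"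
proof
  have S: "(F, h) \<in> S" and \<psi>: "\<psi> \<in> vecs V" using F by (auto simp: weak_solution_def)
  show "tikhonov U V \<beta> \<psi> S G = ereal (Q \<beta> \<psi> F h)" if "G = F"
    using tikhonov_eq[OF \<psi> order_refl S] that by simp
  assume eq: "tikhonov U V \<beta> \<psi> S G = ereal (Q \<beta> \<psi> F h)"
  \<comment> \<open>A finite value forces \<open>G\<close> into the domain of \<open>S\<close>,
    since off it the functional is \<infinity>.\<close>
  then obtain k where k: "(G, k) \<in> S" by (auto simp: tikhonov_def split: if_splits)
  then have "Q \<beta> \<psi> G k = Q \<beta> \<psi> F h" using eq tikhonov_eq[OF \<psi> order_refl k] by simp
  then have "\<beta> * (vnorm U (\<lambda>x. F x - G x))\<^sup>2 \<le> 0"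
    using Q_weak_solution[OF F k] zero_le_power2[of "vnorm V (\<lambda>x. h x - k x)"] by linarith
  then have "vnorm U (\<lambda>x. F x - G x) = 0" using \<beta> by (simp add: mult_le_0_iff)
  then have "F = G" using S_mem[OF S] S_mem[OF k] by (intro eq_if_vnorm_diff_zero)
  then show "G = F" by simp
qed

theorem regularised_least_squares:
  assumes \<beta>: "\<beta> > 0" and \<psi>: "\<psi> \<in> vecs V"
  shows "(\<forall>g\<in>vecs U. \<exists>!f. (f, g) \<in> normal_op U V \<beta> S) \<and>
         (INF f\<in>vecs U. tikhonov U V \<beta> \<psi> T f) = (INF f\<in>vecs U. tikhonov U V \<beta> \<psi> S f) \<and>
         (\<exists>F\<in>vecs U.
           (\<forall>G\<in>vecs U. tikhonov U V \<beta> \<psi> S G = (INF f\<in>vecs U. tikhonov U V \<beta> \<psi> S f)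
              \<longleftrightarrow> G = F) \<and>
           (\<psi> \<in> Domain (adjoint_op U V S) \<longrightarrow> (\<psi>, F) \<in> solution_op U V \<beta> S) \<and>
           (\<forall>G. (\<psi>, G) \<in> op_closure V U (solution_op U V \<beta> S) \<longleftrightarrow> G = F))"
proof -
  obtain F h where F: "weak_solution \<beta> \<psi> F h" using ex_weak_solution[OF \<beta> \<psi>] .
  have TS: "T \<subseteq> S" using T_subset_S by auto
  have FU: "F \<in> vecs U" using F S_mem by (auto simp: weak_solution_def)
  show ?thesis
    unfolding INF_tikhonov[OF \<beta> F order_refl TS] INF_tikhonov[OF \<beta> F TS order_refl]
      tikhonov_minimal_iff[OF \<beta> F] closure_solution_op_iff[OF \<beta> F]
    using ex1_normal_op[OF \<beta>] F FU by (auto simp: solution_op_iff)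
qed

end

section \<open>Completeness of \<open>L\<^sup>2\<close>\<close>

lemma vecs_L2: "f \<in> vecs (L2 M) \<longleftrightarrow> f \<in> borel_measurable M \<and> integrable M (\<lambda>x. (cmod (f x))\<^sup>2)"
  and cip_L2: "cip (L2 M) f g = (LINT x|M. cnj (f x) * g x)"
  by (simp_all add: L2_def)

lemma integrable_cnj_mult:
  assumes "f \<in> vecs (L2 M)" "g \<in> vecs (L2 M)"
  shows "integrable M (\<lambda>x. cnj (f x) * g x)"
proof (rule Bochner_Integration.integrable_bound)
  show "integrable M (\<lambda>x. (cmod (f x))\<^sup>2 + (cmod (g x))\<^sup>2)" using assms by (simp add: vecs_L2)
  show "AE x in M. norm (cnj (f x) * g x) \<le> norm ((cmod (f x))\<^sup>2 + (cmod (g x))\<^sup>2)"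
  proof (rule AE_I2)
    fix x
    have "2 * (cmod (f x) * cmod (g x)) \<le> (cmod (f x))\<^sup>2 + (cmod (g x))\<^sup>2"
      using sum_squares_bound[of "cmod (f x)" "cmod (g x)"] by simp
    moreover have "0 \<le> cmod (f x) * cmod (g x)" by simp
    ultimately have "cmod (f x) * cmod (g x) \<le> (cmod (f x))\<^sup>2 + (cmod (g x))\<^sup>2" by linarith
    then show "norm (cnj (f x) * g x) \<le> norm ((cmod (f x))\<^sup>2 + (cmod (g x))\<^sup>2)"
      by (simp add: norm_mult)
  qed
  show "(\<lambda>x. cnj (f x) * g x) \<in> borel_measurable M"
  proof (rule borel_measurable_times)
    have "cnj \<in> borel_measurable borel"
      by (intro borel_measurable_continuous_onI continuous_on_cnj continuous_on_id)
    then show "(\<lambda>x. cnj (f x)) \<in> borel_measurable M"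
      using assms by (auto simp: vecs_L2 intro: measurable_compose[of f])
  qed (use assms in \<open>simp add: vecs_L2\<close>)
qed

lemma cip_L2_self: "cip (L2 M) f f = complex_of_real (LINT x|M. (cmod (f x))\<^sup>2)"
proof -
  have "cnj (f x) * f x = complex_of_real ((cmod (f x))\<^sup>2)" for x
    by (simp add: complex_norm_square mult.commute del: of_real_power)
  then show ?thesis by (simp add: cip_L2 del: of_real_power)
qed

lemma vnorm_L2: "vnorm (L2 M) f = sqrt (LINT x|M. (cmod (f x))\<^sup>2)"
  by (simp add: vnorm_def cip_L2_self)

lemma nn_integral_L2:
  assumes "f \<in> vecs (L2 M)"
  shows "(\<integral>\<^sup>+x. ennreal ((cmod (f x))\<^sup>2) \<partial>M) = ennreal ((vnorm (L2 M) f)\<^sup>2)"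
  using assms by (simp add: vnorm_L2 vecs_L2 nn_integral_eq_integral integral_nonneg_AE)

text \<open>Turns the output of Fatou's lemma, a bound on a nonnegative integral, into
  membership.\<close>

lemma vecs_L2_if_nn_integral_le:
  assumes "f \<in> borel_measurable M" "(\<integral>\<^sup>+x. ennreal ((cmod (f x))\<^sup>2) \<partial>M) \<le> ennreal B"
  shows "f \<in> vecs (L2 M)"
proof -
  have "integrable M (\<lambda>x. (cmod (f x))\<^sup>2)"
    using assms by (intro integrableI_bounded) (auto simp: le_less_trans[OF _ ennreal_less_top])
  then show ?thesis using assms by (simp add: vecs_L2)
qed

lemma lin_subspace_L2: "lin_subspace (vecs (L2 M))"
proof -
  have "(\<lambda>x. f x + g x) \<in> vecs (L2 M)" if f: "f \<in> vecs (L2 M)" and g: "g \<in> vecs (L2 M)" for f g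
  proof -
    have "integrable M (\<lambda>x. (cmod (f x + g x))\<^sup>2)"
    proof (rule Bochner_Integration.integrable_bound)
      show "integrable M (\<lambda>x. 2 * (cmod (f x))\<^sup>2 + 2 * (cmod (g x))\<^sup>2)"
        using f g by (simp add: vecs_L2)
      show "AE x in M. norm ((cmod (f x + g x))\<^sup>2) \<le> norm (2 * (cmod (f x))\<^sup>2 + 2 * (cmod (g x))\<^sup>2)"
      proof (rule AE_I2)
        fix x
        have "(cmod (f x + g x))\<^sup>2 \<le> (cmod (f x) + cmod (g x))\<^sup>2"
          by (intro power_mono norm_triangle_ineq) simp
        then show "norm ((cmod (f x + g x))\<^sup>2) \<le> norm (2 * (cmod (f x))\<^sup>2 + 2 * (cmod (g x))\<^sup>2)"
          using sum_squares_bound[of "cmod (f x)" "cmod (g x)"] by (simp add: power2_sum)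
      qed
    qed (use f g in \<open>auto simp: vecs_L2\<close>)
    then show ?thesis using f g by (auto simp: vecs_L2)
  qed
  moreover have "(\<lambda>x. c * f x) \<in> vecs (L2 M)" if "f \<in> vecs (L2 M)" for c f
    using that by (auto simp: vecs_L2 norm_mult power_mult_distrib)
  ultimately show ?thesis by (auto simp: lin_subspace_def vecs_L2)
qed

lemma semi_inner_space_L2: "semi_inner_space (L2 M)"
proof
  show "lin_subspace (vecs (L2 M))" by (rule lin_subspace_L2)
  show "cip (L2 M) g f = cnj (cip (L2 M) f g)" for f g
    using Bochner_Integration.integral_cnj[of M "\<lambda>x. cnj (f x) * g x"]
    by (simp add: cip_L2 mult.commute del: Bochner_Integration.integral_cnj)
  show "cip (L2 M) f (\<lambda>x. g x + h x) = cip (L2 M) f g + cip (L2 M) f h"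
    if "f \<in> vecs (L2 M)" "g \<in> vecs (L2 M)" "h \<in> vecs (L2 M)" for f g h
    using that by (simp add: cip_L2 distrib_left integrable_cnj_mult)
  show "cip (L2 M) f (\<lambda>x. c * g x) = c * cip (L2 M) f g" for f g c
    by (simp add: cip_L2 mult.left_commute)
  show "0 \<le> Re (cip (L2 M) f f)" for f
    by (simp add: cip_L2_self integral_nonneg_AE)
qed

text \<open>Weighting the squared increments by 4^n leaves integrals of at most 4^n / 8^n = 2^(-n),
  so the weighted series is finite almost everywhere. There it dominates the increments up to a
  geometric series, and the sequence telescopes.\<close>

lemma L2_AE_convergent:
  assumes u: "\<And>n. u n \<in> vecs (L2 M)"
    and fast: "\<And>n. (vnorm (L2 M) (\<lambda>x. u (Suc n) x - u n x))\<^sup>2 \<le> (1 / 8) ^ n"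
  shows "AE x in M. convergent (\<lambda>n. u n x)"
proof -
  note [measurable] = u[unfolded vecs_L2, THEN conjunct1]
  interpret semi_inner_space "L2 M" by (rule semi_inner_space_L2)
  let ?d = "\<lambda>n x. 4 ^ n * (cmod (u (Suc n) x - u n x))\<^sup>2"
  have "(\<integral>\<^sup>+x. (\<Sum>n. ennreal (?d n x)) \<partial>M) = (\<Sum>n. \<integral>\<^sup>+x. ennreal (?d n x) \<partial>M)"
    by (intro nn_integral_suminf) measurable
  also have "\<dots> \<le> (\<Sum>n. ennreal ((1 / 2) ^ n))"
  proof (rule suminf_le)
    fix n
    have "(\<integral>\<^sup>+x. ennreal (?d n x) \<partial>M) = ennreal (4 ^ n) * (\<integral>\<^sup>+x. ennreal ((cmod (u (Suc n) x - u n x))\<^sup>2) \<partial>M)"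
      by (subst nn_integral_cmult[symmetric]) (measurable, simp only: ennreal_mult zero_le_power zero_le_numeral zero_le_power2)
    also have "\<dots> = ennreal (4 ^ n * (vnorm (L2 M) (\<lambda>x. u (Suc n) x - u n x))\<^sup>2)"
      by (subst nn_integral_L2) (use u in \<open>simp_all only: diff_mem ennreal_mult zero_le_power zero_le_numeral zero_le_power2\<close>)
    also have "\<dots> \<le> ennreal (4 ^ n * (1 / 8) ^ n)"
      by (intro ennreal_leI mult_left_mono fast) simp
    also have "(4 :: real) ^ n * (1 / 8) ^ n = (1 / 2) ^ n"
      by (simp flip: power_mult_distrib)
    finally show "(\<integral>\<^sup>+x. ennreal (?d n x) \<partial>M) \<le> ennreal ((1 / 2) ^ n)" .
  qed auto
  also have "\<dots> = ennreal (\<Sum>n. (1 / 2) ^ n)"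
    by (rule suminf_ennreal2) (auto intro: summable_geometric)
  finally have "(\<integral>\<^sup>+x. (\<Sum>n. ennreal (?d n x)) \<partial>M) \<noteq> \<infinity>"
    by (auto simp: top_unique)
  then have "AE x in M. (\<Sum>n. ennreal (?d n x)) \<noteq> \<infinity>"
    by (intro nn_integral_PInf_AE) measurable
  then show ?thesis
  proof eventually_elim
    fix x assume fin: "(\<Sum>n. ennreal (?d n x)) \<noteq> \<infinity>"
    have sd: "summable (\<lambda>n. ?d n x)" by (rule summable_suminf_not_top) (use fin in simp_all)
    have "summable (\<lambda>n. u (Suc n) x - u n x)"
    proof (rule summable_comparison_test'[where N = 0])
      show "summable (\<lambda>n. (1 / 4) ^ n + ?d n x)"
        by (intro summable_add sd summable_geometric) simp
      fix n
      define a where "a = cmod (u (Suc n) x - u n x)"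
      \<comment> \<open>Writing \<open>a\<close> as the product of 2^(-n) and 2^n a, the
        arithmetic-geometric mean inequality bounds it by the square that is known to be summable
        plus 4^(-n).\<close>
      have "2 * ((1 / 2) ^ n * (2 ^ n * a)) \<le> ((1 / 2) ^ n)\<^sup>2 + (2 ^ n * a)\<^sup>2"
        using sum_squares_bound[of "(1 / 2) ^ n" "2 ^ n * a"] by simp
      also have "(1 / 2) ^ n * (2 ^ n * a) = a" by (simp add: power_one_over)
      also have "((1 / 2 :: real) ^ n)\<^sup>2 = (1 / 4) ^ n"
        by (simp add: power2_eq_square flip: power_mult_distrib)
      also have "(2 ^ n * a)\<^sup>2 = 4 ^ n * a\<^sup>2"
        using power_mult_distrib[of "2 :: real" 2 n] by (simp add: power2_eq_square)
      finally have "2 * a \<le> (1 / 4) ^ n + 4 ^ n * a\<^sup>2" .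
      moreover have "0 \<le> a" by (simp add: a_def)
      ultimately have "a \<le> (1 / 4) ^ n + 4 ^ n * a\<^sup>2" by linarith
      then show "norm (u (Suc n) x - u n x) \<le> (1 / 4) ^ n + ?d n x"
        by (simp add: a_def)
    qed
    then have "summable (\<lambda>n. u (Suc n) x - u n x)" .
    then have "convergent (\<lambda>n. \<Sum>i<n. u (Suc i) x - u i x)"
      by (simp add: summable_iff_convergent)
    then have "convergent (\<lambda>n. u n x - u 0 x)" by (simp only: sum_lessThan_telescope[of "\<lambda>n. u n x"])
    then have "convergent (\<lambda>n. u n x - u 0 x + u 0 x)" by (intro convergent_add convergent_const)
    then show "convergent (\<lambda>n. u n x)" by simp
  qed
qed

text \<open>The Riesz-Fischer argument: a rapidly convergent subsequence has a limit almost
  everywhere, and Fatou's lemma upgrades this to norm convergence of the whole sequence.\<close>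

lemma L2_complete:
  assumes u: "\<And>n. u n \<in> vecs (L2 M)" and C: "cauchy_in (L2 M) u"
  shows "\<exists>f\<in>vecs (L2 M). conv_to (L2 M) u f"
proof -
  interpret semi_inner_space "L2 M" by (rule semi_inner_space_L2)
  note um [measurable] = u[unfolded vecs_L2, THEN conjunct1]
  have "\<exists>N. \<forall>m\<ge>N. \<forall>n\<ge>N. vnorm (L2 M) (\<lambda>x. u m x - u n x) < sqrt ((1 / 8) ^ k)" for k
    using C unfolding cauchy_in_def by simp
  then obtain N where N: "\<And>k m n. N k \<le> m \<Longrightarrow> N k \<le> n \<Longrightarrow>
      vnorm (L2 M) (\<lambda>x. u m x - u n x) < sqrt ((1 / 8) ^ k)" by metis
  \<comment> \<open>The partial sum makes \<open>r j\<close> exceed every \<open>N k\<close> with k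
    \<le> j, so consecutive members of the subsequence satisfy the bound of index k.\<close>
  define r where "r k = k + (\<Sum>i\<le>k. N i)" for k
  have rN: "N k \<le> r j" if "k \<le> j" for k j
    using member_le_sum[of k "{..j}" N] that by (simp add: r_def)
  define w where "w k = u (r k)" for k
  have wV: "w k \<in> vecs (L2 M)" for k by (simp add: w_def u)
  have fast: "(vnorm (L2 M) (\<lambda>x. w (Suc k) x - w k x))\<^sup>2 \<le> (1 / 8) ^ k" for k
  proof -
    have "vnorm (L2 M) (\<lambda>x. w (Suc k) x - w k x) < sqrt ((1 / 8) ^ k)"
      unfolding w_def by (intro N rN) auto
    then have "(vnorm (L2 M) (\<lambda>x. w (Suc k) x - w k x))\<^sup>2 \<le> (sqrt ((1 / 8) ^ k))\<^sup>2"
      by (intro power_mono vnorm_nonneg diff_mem wV) auto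
    then show ?thesis by simp
  qed
  \<comment> \<open>Where the subsequence diverges, \<open>lim\<close> is an unspecified value; this
    happens only on a null set and does not spoil measurability.\<close>
  define f where "f x = lim (\<lambda>k. w k x)" for x
  have [measurable]: "w k \<in> borel_measurable M" for k by (simp add: w_def)
  have fm [measurable]: "f \<in> borel_measurable M" unfolding f_def by measurable
  have AEf: "AE x in M. (\<lambda>k. w k x) \<longlonglongrightarrow> f x"
    using L2_AE_convergent[OF wV fast] by eventually_elim (simp add: f_def convergent_LIMSEQ_iff)
  \<comment> \<open>Fatou's lemma in j with m fixed: \<open>u m - w j\<close> has small norm for all
    large j, and the bound survives in the limit.\<close>
  have Fatou: "(\<integral>\<^sup>+x. ennreal ((cmod (u m x - f x))\<^sup>2) \<partial>M) \<le> ennreal ((1 / 8) ^ k)"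
    if m: "N k \<le> m" for k m
  proof -
    have "(\<integral>\<^sup>+x. ennreal ((cmod (u m x - f x))\<^sup>2) \<partial>M)
        = (\<integral>\<^sup>+x. liminf (\<lambda>j. ennreal ((cmod (u m x - w j x))\<^sup>2)) \<partial>M)"
    proof (rule nn_integral_cong_AE, use AEf in eventually_elim)
      fix x assume "(\<lambda>k. w k x) \<longlonglongrightarrow> f x"
      then have "(\<lambda>j. ennreal ((cmod (u m x - w j x))\<^sup>2)) \<longlonglongrightarrow> ennreal ((cmod (u m x - f x))\<^sup>2)"
        by (intro tendsto_intros)
      then show "ennreal ((cmod (u m x - f x))\<^sup>2) = liminf (\<lambda>j. ennreal ((cmod (u m x - w j x))\<^sup>2))"
        by (rule lim_imp_Liminf[OF sequentially_bot, symmetric])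
    qed
    also have "\<dots> \<le> liminf (\<lambda>j. \<integral>\<^sup>+x. ennreal ((cmod (u m x - w j x))\<^sup>2) \<partial>M)"
      by (intro nn_integral_liminf) measurable
    also have "\<dots> \<le> limsup (\<lambda>j. \<integral>\<^sup>+x. ennreal ((cmod (u m x - w j x))\<^sup>2) \<partial>M)"
      by (rule Liminf_le_Limsup) simp
    also have "\<dots> \<le> ennreal ((1 / 8) ^ k)"
    proof (rule Limsup_bounded, rule eventually_sequentiallyI)
      fix j assume "k \<le> j"
      then have "vnorm (L2 M) (\<lambda>x. u m x - w j x) < sqrt ((1 / 8) ^ k)"
        unfolding w_def by (intro N rN m)
      then have "(vnorm (L2 M) (\<lambda>x. u m x - w j x))\<^sup>2 \<le> (sqrt ((1 / 8) ^ k))\<^sup>2"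
        by (intro power_mono vnorm_nonneg diff_mem wV u) auto
      then show "(\<integral>\<^sup>+x. ennreal ((cmod (u m x - w j x))\<^sup>2) \<partial>M) \<le> ennreal ((1 / 8) ^ k)"
        using u wV by (subst nn_integral_L2) auto
    qed
    finally show ?thesis .
  qed
  have dV: "(\<lambda>x. u m x - f x) \<in> vecs (L2 M)" if "N k \<le> m" for k m
    by (rule vecs_L2_if_nn_integral_le[OF _ Fatou[OF that]]) measurable
  \<comment> \<open>Fatou's bound gives membership of \<open>u (N 0) - f\<close> only; subtracting
    it from \<open>u (N 0)\<close> recovers \<open>f\<close>.\<close>
  have "(\<lambda>x. u (N 0) x - (u (N 0) x - f x)) \<in> vecs (L2 M)"
    by (intro diff_mem u dV[OF order_refl])
  then have fV: "f \<in> vecs (L2 M)" by simp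
  have "(\<lambda>n. vnorm (L2 M) (\<lambda>x. u n x - f x)) \<longlonglongrightarrow> 0"
  proof (rule LIMSEQ_I)
    fix e :: real assume "e > 0"
    then obtain k where k: "(1 / 8) ^ k < e\<^sup>2" using real_arch_pow_inv[of "e\<^sup>2" "1 / 8"] by auto
    have "norm (vnorm (L2 M) (\<lambda>x. u n x - f x) - 0) < e" if n: "N k \<le> n" for n
    proof -
      have "(vnorm (L2 M) (\<lambda>x. u n x - f x))\<^sup>2 \<le> (1 / 8) ^ k"
        using Fatou[OF n] unfolding nn_integral_L2[OF dV[OF n]] by (simp add: ennreal_le_iff)
      then have "(vnorm (L2 M) (\<lambda>x. u n x - f x))\<^sup>2 < e\<^sup>2" using k by simp
      then show ?thesis using \<open>e > 0\<close> dV[OF n] by (simp add: power2_less_imp_less)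
    qed
    then show "\<exists>no. \<forall>n\<ge>no. norm (vnorm (L2 M) (\<lambda>x. u n x - f x) - 0) < e" by blast
  qed
  with fV show ?thesis by (auto simp: conv_to_def)
qed

lemma semi_hilbert_space_L2: "semi_hilbert_space (L2 M)"
  by (intro semi_hilbert_space.intro semi_inner_space_L2 semi_hilbert_space_axioms.intro L2_complete)

section \<open>Specialisation to the evaluation operator into L2\<close>

theorem theorem6p1:
  fixes X :: "'a set" and K :: "'a \<Rightarrow> 'a \<Rightarrow> complex" and H :: "'a fun_space"
    and M :: "'a measure" and D :: "('a \<Rightarrow> complex) set" and T Tc :: "'a linop"
    and \<beta> :: real and \<psi> :: "'a \<Rightarrow> complex"
  assumes "pos_def_kernel X K"
    and "rkhs X K H"
    and "space M = X"
    and "sigma_finite_measure M"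
    and "lin_subspace D"
    and "D \<subseteq> eval_max_dom M H"
    and "T = eval_op M D"
    and "dense_in H (Domain T)"
    and "closable H (L2 M) T"
    and "Tc = op_closure H (L2 M) T"
    and "\<beta> > 0"
    and "\<psi> \<in> vecs (L2 M)"
  shows "(\<forall>g\<in>vecs H. \<exists>!f. (f, g) \<in> normal_op H (L2 M) \<beta> Tc) \<and>
         (INF f\<in>vecs H. tikhonov H (L2 M) \<beta> \<psi> T f) =
         (INF f\<in>vecs H. tikhonov H (L2 M) \<beta> \<psi> Tc f) \<and>
         (\<exists>F\<in>vecs H.
           (\<forall>G\<in>vecs H. tikhonov H (L2 M) \<beta> \<psi> Tc G =
                          (INF f\<in>vecs H. tikhonov H (L2 M) \<beta> \<psi> Tc f) \<longleftrightarrow> G = F) \<and>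
           (\<psi> \<in> Domain (adjoint_op H (L2 M) Tc) \<longrightarrow> (\<psi>, F) \<in> solution_op H (L2 M) \<beta> Tc) \<and>
           (\<forall>G. (\<psi>, G) \<in> op_closure (L2 M) H (solution_op H (L2 M) \<beta> Tc) \<longleftrightarrow> G = F))"
proof -
  have hilbert: "hilbert_fun_space H" using assms(2) by (simp add: rkhs_def)
  have DH: "f \<in> vecs H" if "f \<in> D" for f using assms(6) that by (auto simp: eval_max_dom_def)
  note zero = lin_subspace_zero[OF assms(5)] lin_subspace_zero[OF lin_subspace_L2[of M]]
    and add = lin_subspace_add[OF assms(5)] lin_subspace_add[OF lin_subspace_L2[of M]]
    and scale = lin_subspace_scale[OF assms(5)] lin_subspace_scale[OF lin_subspace_L2[of M]]
  interpret H: semi_hilbert_space H by (rule hilbert_imp_semi_hilbert[OF hilbert])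
  interpret V: semi_hilbert_space "L2 M" by (rule semi_hilbert_space_L2)
  \<comment> \<open>The graph contains every representative of each value, so its linearity reduces
    to that of \<open>D\<close> and of L2, together with the stability of almost everywhere equality
    under sums and multiples.\<close>
  interpret closable_operator H "L2 M" T
  proof
    show "f = (\<lambda>_. 0)" if "f \<in> vecs H" "cip H f f = 0" for f
      using that by (rule hilbert_fun_space.cip_definite[OF hilbert])
    show "f \<in> vecs H \<and> h \<in> vecs (L2 M)" if "(f, h) \<in> T" for f h
      using that DH by (auto simp: assms(7) eval_op_def)
    show "((\<lambda>_. 0), (\<lambda>_. 0)) \<in> T"
      using zero by (auto simp: assms(7) eval_op_def)
    show "((\<lambda>x. f x + f' x), (\<lambda>x. h x + h' x)) \<in> T" if "(f, h) \<in> T" "(f', h') \<in> T" for f h f' h'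
      using that add by (auto simp: assms(7) eval_op_def)
    show "((\<lambda>x. c * f x), (\<lambda>x. c * h x)) \<in> T" if "(f, h) \<in> T" for f h c
      using that scale by (auto simp: assms(7) eval_op_def)
    show "closable H (L2 M) T" by (rule assms(9))
  qed
  have "S = Tc" by (simp add: S_def assms(10))
  then show ?thesis using regularised_least_squares[OF assms(11,12)] by simp
qed

end
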